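(* Let $(X,(\|\cdot\|_q)_{q\ge 1})$ be a Fréchet sequence algebra under coordinatewise multiplication in which $(e_n)_{n\ge 0}$ is a basis with Property A. Let $B_w$ be a hypercyclic weighted backward shift on $X$, with weight $w=(w_n)_{n\ge 0}$ and $v_n=\prod_{k=0}^n w_k$. Suppose that there exists an increasing sequence $(p_k)_k$ of natural numbers such that, for each $n\ge 0$, $$v_{p_k+n}^{-1}e_{p_k+n}\to 0 \text{ in } X \text{ as } k\to\infty,$$ and such that, for each $n\ge 0$, $$\prod_{\nu=0}^{p_k+n} w_\nu^{-1}\to 0 \text{ in } \mathbb{C} \text{ as } k\to\infty.$$ Then $HC(B_w)$ contains an algebra, except zero, that is not finitely generated; that is, there is a subalgebra $\mathcal{A}$ of $X$ that is not finitely generated and satisfies $\mathcal{A}\setminus\{0\}\subset HC(B_w)$. In other words, $HC(B_w)$ is algebrable.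
   Context: $\omega$ is the space of all complex sequences $x=(x_n)_{n\ge 0}$ with the topology of coordinatewise convergence; $e_n\in\omega$ is the sequence with $1$ at index $n$ and $0$ elsewhere. Coordinatewise multiplication is $xy=(x_ny_n)_n$. A Fréchet algebra is a complex algebra $X$ that is a (locally convex) Fréchet space whose topology is induced by an increasing sequence $(\|\cdot\|_q)_{q\ge1}$ of seminorms with $\|xy\|_q\le\|x\|_q\|y\|_q$ for all $x,y\in X$, $q\ge1$. A Fréchet sequence algebra under coordinatewise multiplication is a subalgebra $X$ of $\omega$ (with that product) that carries a Fréchet algebra structure such that the embedding $X\hookrightarrow\omega$ is continuous. "Basis" means Schauder basis. Property A of $(e_n)_n$: $X$ contains all $e_n$, and for any $r\ge1$ there are $q\ge1$ and $C>0$ such that $\|e_n\|_r^2\le C\|e_n\|_q$ for all $n\ge0$. A weight is a sequence $w=(w_n)_{n\ge0}$ of non-zero complex numbers, with the convention $w_0=1$. The weighted backward shift is $B_w(x_0,x_1,x_2,\dots)=(w_1x_1,w_2x_2,w_3x_3,\dots)$; saying that it is a weighted backward shift on $X$ means that it maps $X$ into $X$ (it is then a continuous linear operator on $X$). For an operator $T$ on $X$, $HC(T)=\{x\in X:\{x,Tx,T^2x,\dots\}\text{ is dense in }X\}$, and $T$ is hypercyclic if $HC(T)\ne\varnothing$. Algebras are not required to be unital; the algebra generated by a set is the smallest subalgebra containing it (the linear span of all finite products of at least one element of the set). An algebra is finitely generated if it is generated by a finite subset. $HC(T)$ is algebrable if $HC(T)\cup\{0\}$ contains a subalgebra of $X$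 that is infinitely but not finitely generated. *)

theory Defs
  imports "HOL-Analysis.Analysis" "HOL-Library.Function_Algebras"
begin

text \<open>
  The space of all complex sequences is the type \<^typ>\<open>nat \<Rightarrow> complex\<close>: its ring operations are the
  coordinatewise ones of \<^theory>\<open>HOL-Library.Function_Algebras\<close>, and its type class topology is the
  product topology, i.e. that of coordinatewise convergence.
\<close>

type_synonym cseq = "nat \<Rightarrow> complex"

definition cscale :: "complex \<Rightarrow> cseq \<Rightarrow> cseq" where
  "cscale c x = (\<lambda>n. c * x n)"

global_interpretation cseq: vector_space cscale
  by unfold_locales (auto simp: cscale_def fun_eq_iff algebra_simps)

definition unit_seq :: "nat \<Rightarrow> cseq" where
  "unit_seq n = (\<lambda>j. if j = n then 1 else 0)"

text \<open>Algebras need not be unital.\<close>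

definition subalgebra :: "cseq set \<Rightarrow> bool" where
  "subalgebra A \<longleftrightarrow> cseq.subspace A \<and> (\<forall>x\<in>A. \<forall>y\<in>A. x * y \<in> A)"

definition generates_algebra :: "cseq set \<Rightarrow> cseq set \<Rightarrow> bool" where
  "generates_algebra S A \<longleftrightarrow> S \<subseteq> A \<and> subalgebra hull S = A"

definition finitely_generated :: "cseq set \<Rightarrow> bool" where
  "finitely_generated A \<longleftrightarrow> (\<exists>S. finite S \<and> generates_algebra S A)"

definition infinitely_generated :: "cseq set \<Rightarrow> bool" where
  "infinitely_generated A \<longleftrightarrow> (\<exists>S. infinite S \<and> generates_algebra S A)"

text \<open>
  A sequence of seminorms on a set \<open>X\<close> of sequences is a function \<open>N\<close>, of which only the values
  \<open>N q x\<close> with \<open>q \<ge> 1\<close> and \<open>x \<in> X\<close> are relevant.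
\<close>

definition seminorm_on :: "cseq set \<Rightarrow> (cseq \<Rightarrow> real) \<Rightarrow> bool" where
  "seminorm_on X p \<longleftrightarrow>
     (\<forall>x\<in>X. 0 \<le> p x) \<and>
     (\<forall>x\<in>X. \<forall>y\<in>X. p (x + y) \<le> p x + p y) \<and>
     (\<forall>c. \<forall>x\<in>X. p (cscale c x) = cmod c * p x)"

definition seminorm_topology :: "cseq set \<Rightarrow> (nat \<Rightarrow> cseq \<Rightarrow> real) \<Rightarrow> cseq topology" where
  "seminorm_topology X N =
     topology_generated_by {{y\<in>X. N q (y - x) < r} | x q r. x \<in> X \<and> 1 \<le> q \<and> 0 < r}"

definition seminorm_Cauchy :: "(nat \<Rightarrow> cseq \<Rightarrow> real) \<Rightarrow> (nat \<Rightarrow> cseq) \<Rightarrow> bool" where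
  "seminorm_Cauchy N s \<longleftrightarrow>
     (\<forall>q\<ge>1. \<forall>\<epsilon>>0. \<exists>M. \<forall>m\<ge>M. \<forall>n\<ge>M. N q (s m - s n) < \<epsilon>)"

text \<open>
  The topology is given by countably many seminorms, so once it is Hausdorff it is metrizable, and
  completeness is sequential completeness.
\<close>

definition frechet_space :: "cseq set \<Rightarrow> (nat \<Rightarrow> cseq \<Rightarrow> real) \<Rightarrow> bool" where
  "frechet_space X N \<longleftrightarrow>
     cseq.subspace X \<and>
     (\<forall>q\<ge>1. seminorm_on X (N q)) \<and>
     (\<forall>q\<ge>1. \<forall>x\<in>X. N q x \<le> N (Suc q) x) \<and>
     Hausdorff_space (seminorm_topology X N) \<and>
     (\<forall>s. range s \<subseteq> X \<and> seminorm_Cauchy N s \<longrightarrow>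
        (\<exists>x. limitin (seminorm_topology X N) s x sequentially))"

definition frechet_sequence_algebra :: "cseq set \<Rightarrow> (nat \<Rightarrow> cseq \<Rightarrow> real) \<Rightarrow> bool" where
  "frechet_sequence_algebra X N \<longleftrightarrow>
     subalgebra X \<and>
     frechet_space X N \<and>
     (\<forall>q\<ge>1. \<forall>x\<in>X. \<forall>y\<in>X. N q (x * y) \<le> N q x * N q y) \<and>
     continuous_map (seminorm_topology X N) euclidean (\<lambda>x. x)"

definition schauder_basis :: "cseq set \<Rightarrow> (nat \<Rightarrow> cseq \<Rightarrow> real) \<Rightarrow> (nat \<Rightarrow> cseq) \<Rightarrow> bool" where
  "schauder_basis X N b \<longleftrightarrow>
     range b \<subseteq> X \<and>
     (\<forall>x\<in>X. \<exists>!a. limitin (seminorm_topology X N) (\<lambda>m. \<Sum>n<m. cscale (a n) (b n)) x sequentially)"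

definition property_A :: "cseq set \<Rightarrow> (nat \<Rightarrow> cseq \<Rightarrow> real) \<Rightarrow> bool" where
  "property_A X N \<longleftrightarrow>
     (\<forall>n. unit_seq n \<in> X) \<and>
     (\<forall>r\<ge>1. \<exists>q\<ge>1. \<exists>C>0. \<forall>n. (N r (unit_seq n))\<^sup>2 \<le> C * N q (unit_seq n))"

definition weight :: "(nat \<Rightarrow> complex) \<Rightarrow> bool" where
  "weight w \<longleftrightarrow> w 0 = 1 \<and> (\<forall>n. w n \<noteq> 0)"

definition backward_shift :: "(nat \<Rightarrow> complex) \<Rightarrow> cseq \<Rightarrow> cseq" where
  "backward_shift w x = (\<lambda>n. w (Suc n) * x (Suc n))"

text \<open>
  Continuity on \<open>X\<close> is not required here: it follows from the closed graph theorem.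
\<close>

definition weighted_shift_on :: "cseq set \<Rightarrow> (nat \<Rightarrow> complex) \<Rightarrow> bool" where
  "weighted_shift_on X w \<longleftrightarrow> weight w \<and> backward_shift w ` X \<subseteq> X"

definition HC :: "cseq set \<Rightarrow> (nat \<Rightarrow> cseq \<Rightarrow> real) \<Rightarrow> (cseq \<Rightarrow> cseq) \<Rightarrow> cseq set" where
  "HC X N T = {x\<in>X. seminorm_topology X N closure_of (range (\<lambda>k. (T ^^ k) x)) = X}"

definition hypercyclic :: "cseq set \<Rightarrow> (nat \<Rightarrow> cseq \<Rightarrow> real) \<Rightarrow> (cseq \<Rightarrow> cseq) \<Rightarrow> bool" where
  "hypercyclic X N T \<longleftrightarrow> HC X N T \<noteq> {}"

definition algebrable :: "cseq set \<Rightarrow> cseq set \<Rightarrow> bool" where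
  "algebrable X E \<longleftrightarrow>
     (\<exists>A. subalgebra A \<and> A \<subseteq> X \<and> infinitely_generated A \<and> \<not> finitely_generated A \<and>
          A \<subseteq> E \<union> {0})"

end

theory Submission
  imports Defs "HOL-Library.Countable"
begin

text \<open>
  Fix a sequence \<open>U\<close> of complex numbers with non-positive real parts. The sequences \<open>exp (t U)\<close>, cut off
  outside a union of disjoint blocks, form a multiplicative semigroup in \<open>t > 0\<close>, so their span over
  the positive rationals is an algebra. The block starting at \<open>m\<close> realises a pair of an exponent \<open>s\<close>
  and a finitely supported \<open>y\<close>: there \<open>exp (s U\<^bsub>m+n\<^esub>) = v\<^sub>n y\<^sub>n / v\<^bsub>m+n\<^esub>\<close>, which \<open>B\<^sup>m\<close> maps to \<open>y\<close>.
  Since \<open>v\<^bsub>m+n\<^esub>\<close> is large, the generators of exponent larger than \<open>s\<close> are negligible on this block.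
  Hence in any linear combination the term of smallest exponent alone decides the orbit at the blocks
  made for that exponent, and the orbit is dense because every exponent is paired with a dense set of
  vectors \<open>y\<close>. By Property A even the roots \<open>|v\<^sub>l|\<^sup>-\<^sup>\<rho> e\<^sub>l\<close> tend to 0 along the blocks, so that all
  generators lie in \<open>X\<close>.
\<close>

lemma cscale_apply [simp]: "cscale c x n = c * x n"
  by (simp add: cscale_def)

lemma sum_seq_apply: "(\<Sum>i\<in>I. f i) (n::nat) = (\<Sum>i\<in>I. (f i n :: complex))"
  by (induction I rule: infinite_finite_induct) auto

section \<open>Frechet sequence algebras\<close>

locale sequence_algebra =
  fixes X :: "cseq set" and N :: "nat \<Rightarrow> cseq \<Rightarrow> real"
  assumes frechet: "frechet_sequence_algebra X N"
begin

abbreviation "\<T> \<equiv> seminorm_topology X N"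

section \<open>Seminorm calculus on the algebra\<close>

lemma subspace_X: "cseq.subspace X"
  using frechet by (auto simp: frechet_sequence_algebra_def frechet_space_def)

lemmas X_zero = cseq.subspace_0[OF subspace_X]
  and X_diff = cseq.subspace_diff[OF subspace_X]
  and X_scale = cseq.subspace_scale[OF subspace_X]
  and X_sum = cseq.subspace_sum[OF subspace_X]

lemma seminorm_on_N: "1 \<le> q \<Longrightarrow> seminorm_on X (N q)"
  using frechet by (auto simp: frechet_sequence_algebra_def frechet_space_def)

lemma N_nonneg: "1 \<le> q \<Longrightarrow> x \<in> X \<Longrightarrow> 0 \<le> N q x"
  using seminorm_on_N by (auto simp: seminorm_on_def)

lemma N_triangle: "1 \<le> q \<Longrightarrow> x \<in> X \<Longrightarrow> y \<in> X \<Longrightarrow> N q (x + y) \<le> N q x + N q y"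
  using seminorm_on_N by (auto simp: seminorm_on_def)

lemma N_scale: "1 \<le> q \<Longrightarrow> x \<in> X \<Longrightarrow> N q (cscale c x) = cmod c * N q x"
  using seminorm_on_N by (auto simp: seminorm_on_def)

lemma N_zero: "1 \<le> q \<Longrightarrow> N q 0 = 0"
  using N_scale[of q 0 0] X_zero by simp

lemma N_minus_commute:
  assumes "1 \<le> q" "x \<in> X" "y \<in> X"
  shows "N q (x - y) = N q (y - x)"
proof -
  have "x - y = cscale (-1) (y - x)"
    by (auto simp: fun_eq_iff)
  then show ?thesis
    using N_scale[of q "y - x" "-1"] X_diff assms by simp
qed

lemma N_triangle_diff:
  assumes "1 \<le> q" "x \<in> X" "y \<in> X" "z \<in> X"
  shows "N q (x - z) \<le> N q (x - y) + N q (y - z)"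
  using N_triangle[of q "x - y" "y - z"] X_diff assms by simp

lemma N_sum_le:
  assumes "1 \<le> q" "\<And>i. i \<in> I \<Longrightarrow> f i \<in> X"
  shows "N q (\<Sum>i\<in>I. f i) \<le> (\<Sum>i\<in>I. N q (f i))"
  using assms(2)
proof (induction I rule: infinite_finite_induct)
  case (insert i I)
  then have "N q (f i + sum f I) \<le> N q (f i) + N q (sum f I)"
    by (intro N_triangle assms(1) X_sum) auto
  moreover have "N q (sum f I) \<le> (\<Sum>i\<in>I. N q (f i))"
    using insert by simp
  ultimately show ?case
    unfolding sum.insert[OF insert.hyps] by linarith
qed (use assms(1) in \<open>auto simp: N_zero\<close>)

lemma N_mono:
  assumes "1 \<le> q" "q \<le> r" "x \<in> X"
  shows "N q x \<le> N r x"
  using assms(2,1,3)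
proof (induction rule: dec_induct)
  case (step r)
  then have "N r x \<le> N (Suc r) x"
    using frechet by (auto simp: frechet_sequence_algebra_def frechet_space_def)
  with step show ?case by force
qed simp

section \<open>Seminorm balls, convergence and series\<close>

lemma openin_seminorm_ball:
  "x \<in> X \<Longrightarrow> 1 \<le> q \<Longrightarrow> 0 < r \<Longrightarrow> openin \<T> {y \<in> X. N q (y - x) < r}"
  unfolding seminorm_topology_def by (rule topology_generated_by_Basis) blast

lemma topspace_seminorm_topology: "topspace \<T> = X"
proof
  show "topspace \<T> \<subseteq> X"
    by (auto simp: seminorm_topology_def)
  show "X \<subseteq> topspace \<T>"
  proof
    fix x assume "x \<in> X"
    moreover from this have "x \<in> {y \<in> X. N 1 (y - x) < 1}"
      by (simp add: N_zero)
    ultimately show "x \<in> topspace \<T>"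
      using openin_seminorm_ball[of x 1 1] openin_subset by fastforce
  qed
qed

text \<open>The generating balls have arbitrary centres and form only a subbasis. The triangle
  inequality recentres a ball at \<open>x\<close>, and since the seminorms increase, the larger of
  two indices handles an intersection.\<close>

lemma openin_contains_seminorm_ball:
  assumes "openin \<T> U" "x \<in> U"
  shows "\<exists>q\<ge>1. \<exists>r>0. {y \<in> X. N q (y - x) < r} \<subseteq> U"
proof -
  have xX: "x \<in> X"
    using assms openin_subset topspace_seminorm_topology by blast
  have "generate_topology_on {{y\<in>X. N q (y - x) < r} | x q r. x \<in> X \<and> 1 \<le> q \<and> 0 < r} U"
    using assms(1) unfolding seminorm_topology_def openin_topology_generated_by_iff .
  from this assms(2) show ?thesis
  proof (induction)
    case (Int a b)
    then obtain q r where q: "q \<ge> 1" "r > 0" "{y \<in> X. N q (y - x) < r} \<subseteq> a"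
      by blast
    from Int obtain q' r' where q': "q' \<ge> 1" "r' > 0" "{y \<in> X. N q' (y - x) < r'} \<subseteq> b"
      by blast
    have "N q (y - x) \<le> N (max q q') (y - x)" "N q' (y - x) \<le> N (max q q') (y - x)" if "y \<in> X" for y
      by (intro N_mono q q' X_diff xX that; simp)+
    then have "{y \<in> X. N (max q q') (y - x) < min r r'} \<subseteq>
        {y \<in> X. N q (y - x) < r} \<inter> {y \<in> X. N q' (y - x) < r'}"
      by (blast intro: order_le_less_trans less_le_trans min.cobounded1 min.cobounded2)
    with q(3) q'(3) have "{y \<in> X. N (max q q') (y - x) < min r r'} \<subseteq> a \<inter> b"
      by blast
    moreover have "1 \<le> max q q'" "0 < min r r'"
      using q q' by auto
    ultimately show ?case by blast
  next
    case (UN K)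
    then show ?case by blast
  next
    case (Basis s)
    then obtain z q r where s: "s = {y \<in> X. N q (y - z) < r}" "z \<in> X" "1 \<le> q" "0 < r"
      by blast
    have "{y \<in> X. N q (y - x) < r - N q (x - z)} \<subseteq> s"
      using N_triangle_diff[OF s(3) _ xX s(2)] s(1) by fastforce
    moreover have "r - N q (x - z) > 0"
      using Basis s by simp
    ultimately show ?case using s by blast
  qed simp
qed

lemma limitin_iff:
  assumes "range s \<subseteq> X"
  shows "limitin \<T> s x sequentially \<longleftrightarrow> x \<in> X \<and> (\<forall>q\<ge>1. (\<lambda>i. N q (s i - x)) \<longlonglongrightarrow> 0)"
proof (intro iffI conjI allI impI)
  assume lim: "limitin \<T> s x sequentially"
  then show xX: "x \<in> X"
    by (simp add: limitin_def topspace_seminorm_topology)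
  fix q :: nat assume q: "1 \<le> q"
  show "(\<lambda>i. N q (s i - x)) \<longlonglongrightarrow> 0"
  proof (rule order_tendstoI)
    fix e :: real assume "e < 0"
    then have "e < N q (s i - x)" for i
      using N_nonneg[OF q X_diff[OF _ xX]] assms by (meson order_less_le_trans range_subsetD)
    then show "\<forall>\<^sub>F i in sequentially. e < N q (s i - x)" by simp
  next
    fix e :: real assume "0 < e"
    moreover from this have "x \<in> {y \<in> X. N q (y - x) < e}"
      using xX q N_zero by simp
    ultimately have "\<forall>\<^sub>F i in sequentially. s i \<in> {y \<in> X. N q (y - x) < e}"
      using lim openin_seminorm_ball[OF xX q] unfolding limitin_def by blast
    then show "\<forall>\<^sub>F i in sequentially. N q (s i - x) < e"
      by (rule eventually_mono) simp
  qed
next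
  assume x: "x \<in> X \<and> (\<forall>q\<ge>1. (\<lambda>i. N q (s i - x)) \<longlonglongrightarrow> 0)"
  show "limitin \<T> s x sequentially"
    unfolding limitin_def topspace_seminorm_topology
  proof (intro conjI allI impI)
    fix U assume "openin \<T> U \<and> x \<in> U"
    then obtain q r where q: "q \<ge> 1" "r > 0" "{y \<in> X. N q (y - x) < r} \<subseteq> U"
      using openin_contains_seminorm_ball by blast
    with x have "\<forall>\<^sub>F i in sequentially. N q (s i - x) < r"
      using order_tendstoD(2) by blast
    then show "\<forall>\<^sub>F i in sequentially. s i \<in> U"
      by (rule eventually_mono) (use q(3) assms in blast)
  qed (use x in blast)
qed

lemma limitin_norm:
  assumes "limitin \<T> s x sequentially" "\<And>i. s i \<in> X" "1 \<le> q"
  shows "(\<lambda>i. N q (s i - x)) \<longlonglongrightarrow> 0"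
proof -
  have "range s \<subseteq> X"
    using assms(2) by blast
  from limitin_iff[OF this] show ?thesis
    using assms(1,3) by simp
qed

text \<open>This is the continuity of the embedding into \<omega> followed by a coordinate
  projection. It serves to identify limits that are only known to exist.\<close>

lemma limitin_coordinate:
  assumes "limitin \<T> s x sequentially"
  shows "(\<lambda>i. s i n) \<longlonglongrightarrow> x n"
proof -
  have "continuous_map \<T> euclidean (\<lambda>x. x)"
    using frechet by (simp add: frechet_sequence_algebra_def)
  from continuous_map_limit[OF this assms] have "s \<longlonglongrightarrow> x"
    by (simp add: o_def)
  moreover have "isCont (\<lambda>x::cseq. x n) x"
    by (rule continuous_on_interior[OF continuous_on_product_coordinates]) simp
  ultimately show ?thesis
    by (rule isCont_tendsto_compose[rotated])
qed

text \<open>Completeness supplies some limit of the partial sums, and its coordinates must be those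
  of \<open>z\<close>. Membership in \<open>X\<close> can thus be checked for a sequence that is
  only given coordinatewise.\<close>

lemma absolutely_convergent_series:
  assumes g: "\<And>i. g i \<in> X" and sm: "\<And>q. 1 \<le> q \<Longrightarrow> summable (\<lambda>i. N q (g i))"
    and z: "\<And>n. (\<lambda>i. g i n) sums z n"
  shows "z \<in> X" and "1 \<le> q \<Longrightarrow> N q z \<le> (\<Sum>i. N q (g i))"
proof -
  define s where "s m = (\<Sum>i<m. g i)" for m
  have sX: "s m \<in> X" for m
    unfolding s_def by (intro X_sum g)
  have step: "N q (s n - s m) \<le> (\<Sum>i=m..<n. N q (g i))" if "1 \<le> q" "m \<le> n" for q m n
  proof -
    have "s n - s m = (\<Sum>i=m..<n. g i)"
      unfolding s_def lessThan_atLeast0 using that by (intro sum_diff_nat_ivl) auto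
    then show ?thesis
      by (simp only:) (intro N_sum_le that g)
  qed
  have "seminorm_Cauchy N s"
    unfolding seminorm_Cauchy_def
  proof (intro allI impI)
    fix q :: nat and e :: real assume q: "1 \<le> q" and e: "0 < e"
    obtain M where M: "\<And>m n. m \<ge> M \<Longrightarrow> norm (\<Sum>i=m..<n. N q (g i)) < e"
      using sm[OF q] e unfolding summable_Cauchy by blast
    have *: "N q (s n - s m) < e" if "M \<le> m" "m \<le> n" for m n
      using step[OF q that(2)] M[OF that(1), of n] by (simp add: abs_less_iff)
    have "N q (s m - s n) < e" if "M \<le> m" "M \<le> n" for m n
      using *[of m n] *[of n m] that N_minus_commute[OF q sX sX, of m n]
      by (cases "m \<le> n") auto
    then show "\<exists>M. \<forall>m\<ge>M. \<forall>n\<ge>M. N q (s m - s n) < e" by blast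
  qed
  moreover have "range s \<subseteq> X"
    using sX by blast
  moreover have "\<forall>s. range s \<subseteq> X \<and> seminorm_Cauchy N s \<longrightarrow> (\<exists>x. limitin \<T> s x sequentially)"
    using frechet unfolding frechet_sequence_algebra_def frechet_space_def by (elim conjE)
  ultimately obtain x where x: "limitin \<T> s x sequentially"
    by blast
  have "x = z"
  proof
    fix n
    have "(\<lambda>m. s m n) \<longlonglongrightarrow> z n"
      using z[of n] by (simp add: s_def sums_def sum_seq_apply)
    then show "x n = z n"
      using limitin_coordinate[OF x] LIMSEQ_unique by blast
  qed
  with x have lim: "z \<in> X" "\<And>q. 1 \<le> q \<Longrightarrow> (\<lambda>i. N q (s i - z)) \<longlonglongrightarrow> 0"
    using limitin_iff[of s x] sX by (auto simp: image_subset_iff)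
  show "z \<in> X" by fact
  assume q: "1 \<le> q"
  have "N q z \<le> N q (s i - z) + (\<Sum>i. N q (g i))" for i
  proof -
    have "N q z \<le> N q (z - s i) + N q (s i)"
      using N_triangle[of q "z - s i" "s i"] X_diff lim sX q by simp
    moreover have "N q (z - s i) = N q (s i - z)"
      by (intro N_minus_commute lim sX q)
    moreover have "N q (s i) \<le> (\<Sum>j<i. N q (g j))"
      unfolding s_def by (intro N_sum_le q g)
    moreover have "\<dots> \<le> (\<Sum>j. N q (g j))"
      using sum_le_suminf[OF sm[OF q]] N_nonneg[OF q g] by simp
    ultimately show ?thesis by linarith
  qed
  moreover have "(\<lambda>i. N q (s i - z) + (\<Sum>i. N q (g i))) \<longlonglongrightarrow> 0 + (\<Sum>i. N q (g i))"
    by (intro tendsto_intros lim q)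
  ultimately have "N q z \<le> 0 + (\<Sum>i. N q (g i))"
    by (intro LIMSEQ_le_const) blast+
  then show "N q z \<le> (\<Sum>i. N q (g i))"
    by simp
qed

end

section \<open>Weighted backward shifts and roots of unit sequences\<close>

locale backward_shift_algebra = sequence_algebra +
  fixes w v :: cseq and p :: "nat \<Rightarrow> nat"
  assumes basis: "schauder_basis X N unit_seq"
    and property_A: "property_A X N"
    and shift: "weighted_shift_on X w"
    and v: "\<And>n. v n = (\<Prod>k=0..n. w k)"
    and strict_mono_p: "strict_mono p"
    and scaled_unit_limit: "\<And>n. limitin \<T>
      (\<lambda>k. cscale (inverse (v (p k + n))) (unit_seq (p k + n))) 0 sequentially"
    and inverse_limit: "\<And>n. (\<lambda>k. inverse (v (p k + n))) \<longlonglongrightarrow> 0"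
begin

abbreviation "B \<equiv> backward_shift w"

lemma unit_seq_X: "unit_seq n \<in> X"
  using property_A by (simp add: property_A_def)

lemma v_nonzero: "v n \<noteq> 0"
  using shift by (auto simp: v weighted_shift_on_def weight_def)

lemma v_Suc: "v (Suc n) = w (Suc n) * v n"
  by (simp add: v mult.commute)

lemma w_Suc_nonzero: "w (Suc n) \<noteq> 0"
  using shift by (simp add: weighted_shift_on_def weight_def)

section \<open>Iterates of the shift and basis expansions\<close>

lemma iterate_apply: "(B ^^ m) z n = v (m + n) / v n * z (m + n)"
proof (induction m arbitrary: n)
  case (Suc m)
  have "(B ^^ Suc m) z n = B ((B ^^ m) z) n"
    by simp
  also have "\<dots> = w (Suc n) * (B ^^ m) z (Suc n)"
    unfolding backward_shift_def[of w "(B ^^ m) z"] ..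
  also have "\<dots> = w (Suc n) * (v (m + Suc n) / v (Suc n) * z (m + Suc n))"
    unfolding Suc ..
  finally show ?case
    by (simp add: v_Suc[of n] w_Suc_nonzero)
qed (simp add: v_nonzero)

lemma iterate_X: "z \<in> X \<Longrightarrow> (B ^^ m) z \<in> X"
  using shift by (induction m) (auto simp: weighted_shift_on_def)

lemma iterate_unit_seq:
  "(B ^^ m) (unit_seq l) = (if m \<le> l then cscale (v l / v (l - m)) (unit_seq (l - m)) else 0)"
  by (auto simp: fun_eq_iff iterate_apply unit_seq_def)

lemma iterate_sum:
  "(B ^^ m) (\<Sum>i\<in>I. cscale (c i) (f i)) = (\<Sum>i\<in>I. cscale (c i) ((B ^^ m) (f i)))"
  by (rule ext) (simp add: iterate_apply sum_seq_apply sum_distrib_left algebra_simps)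

lemma partial_sum_apply:
  "(\<Sum>n<m. cscale (x n) (unit_seq n)) j = (if j < m then x j else 0)"
  by (simp add: sum_seq_apply unit_seq_def if_distrib if_distribR cong: if_cong)

lemma partial_sum_X: "(\<Sum>n<m. cscale (x n) (unit_seq n)) \<in> X"
  by (intro X_sum X_scale unit_seq_X)

text \<open>Coordinates are continuous, so the coefficients provided by the basis can only be the
  coordinates of \<open>x\<close>.\<close>

lemma basis_expansion:
  assumes "x \<in> X"
  shows "limitin \<T> (\<lambda>m. \<Sum>n<m. cscale (x n) (unit_seq n)) x sequentially"
proof -
  from assms basis obtain a
    where a: "limitin \<T> (\<lambda>m. \<Sum>n<m. cscale (a n) (unit_seq n)) x sequentially"
    unfolding schauder_basis_def by blast
  have "a = x"
  proof
    fix j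
    have "(\<lambda>m. if j < m then a j else 0) \<longlonglongrightarrow> x j"
      using limitin_coordinate[OF a, of j] by (simp only: partial_sum_apply)
    moreover have "\<forall>\<^sub>F m in sequentially. (if j < m then a j else 0) = a j"
      using eventually_gt_at_top[of j] by (rule eventually_mono) simp
    then have "(\<lambda>m. if j < m then a j else 0) \<longlonglongrightarrow> a j"
      by (rule tendsto_eventually)
    ultimately show "a j = x j"
      using LIMSEQ_unique by blast
  qed
  with a show ?thesis by simp
qed

lemma basis_expansion_norm:
  assumes "x \<in> X" "1 \<le> q"
  shows "(\<lambda>m. N q ((\<Sum>n<m. cscale (x n) (unit_seq n)) - x)) \<longlonglongrightarrow> 0"
  by (rule limitin_norm[OF basis_expansion[OF assms(1)] partial_sum_X assms(2)])

text \<open>Each term is the difference of two consecutive partial sums, both of which approach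
  \<open>x\<close>.\<close>

lemma basis_term_tendsto_0:
  assumes "x \<in> X" "1 \<le> q"
  shows "(\<lambda>n. N q (cscale (x n) (unit_seq n))) \<longlonglongrightarrow> 0"
proof -
  define s where "s m = (\<Sum>n<m. cscale (x n) (unit_seq n))" for m
  have sX: "s m \<in> X" for m
    unfolding s_def by (rule partial_sum_X)
  have s: "(\<lambda>m. N q (s m - x)) \<longlonglongrightarrow> 0"
    unfolding s_def by (rule basis_expansion_norm[OF assms])
  have lim: "(\<lambda>n. N q (s (Suc n) - x) + N q (s n - x)) \<longlonglongrightarrow> 0 + 0"
    by (intro tendsto_add LIMSEQ_Suc s)
  have le: "N q (cscale (x n) (unit_seq n)) \<le> N q (s (Suc n) - x) + N q (s n - x)" for n
  proof -
    have "cscale (x n) (unit_seq n) = s (Suc n) - s n"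
      by (simp add: s_def)
    moreover have "N q (s (Suc n) - s n) \<le> N q (s (Suc n) - x) + N q (x - s n)"
      by (intro N_triangle_diff assms sX)
    moreover have "N q (x - s n) = N q (s n - x)"
      by (intro N_minus_commute assms sX)
    ultimately show ?thesis by simp
  qed
  have ge: "0 \<le> N q (cscale (x n) (unit_seq n))" for n
    by (intro N_nonneg X_scale unit_seq_X assms)
  have "\<forall>\<^sub>F n in sequentially. norm (N q (cscale (x n) (unit_seq n))) \<le> N q (s (Suc n) - x) + N q (s n - x)"
    using ge le by (intro always_eventually allI) (simp only: real_norm_def abs_of_nonneg)
  then show ?thesis
    using lim unfolding add_0_right by (rule Lim_null_comparison)
qed

text \<open>
  A gliding hump replaces the closed graph theorem: if the bound failed, a sparse series of
  multiples of unit sequences would converge in \<open>X\<close> although the terms of its image do not tend to 0.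
\<close>

lemma iterate_unit_seq_bound:
  assumes q: "1 \<le> q"
  shows "\<exists>r\<ge>1. \<exists>C\<ge>0. \<exists>K. \<forall>l\<ge>K. N q ((B ^^ j) (unit_seq l)) \<le> C * N r (unit_seq l)"
proof (rule ccontr)
  assume "\<not> ?thesis"
  then have ex: "\<exists>l\<ge>K. C * N r (unit_seq l) < N q ((B ^^ j) (unit_seq l))"
    if "1 \<le> r" "0 \<le> C" for r C K
    using that by (metis linorder_not_le)
  \<comment> \<open>The seminorm index grows together with the constant, so that every fixed
    seminorm is eventually controlled. The condition \<open>j \<le> l\<close> keeps
    \<open>B ^^ j\<close> from annihilating the unit sequence.\<close>
  let ?P = "\<lambda>i l. j \<le> l \<and> 2 ^ i * N (Suc i) (unit_seq l) < N q ((B ^^ j) (unit_seq l))"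
  have "\<exists>h. \<forall>i. ?P i (h i) \<and> h i < h (Suc i)"
  proof (rule dependent_nat_choice)
    show "\<exists>l. ?P 0 l"
      using ex[of 1 1 j] by auto
    show "\<exists>l'. ?P (Suc i) l' \<and> l < l'" if "?P i l" for i l
      using ex[of "Suc (Suc i)" "2 ^ Suc i" "Suc l + j"]
      by (metis Suc_leD Suc_le_eq add_leD1 add_leD2 le_add2 plus_1_eq_Suc zero_le_numeral zero_le_power)
  qed
  then obtain h where h: "\<And>i. j \<le> h i"
      "\<And>i. 2 ^ i * N (Suc i) (unit_seq (h i)) < N q ((B ^^ j) (unit_seq (h i)))"
      "\<And>i. h i < h (Suc i)"
    by blast
  have mono_h: "strict_mono h"
    using h(3) by (rule strict_monoI_Suc)
  \<comment> \<open>The normalisation gives every image under \<open>B ^^ j\<close> of a hump the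
    \<open>q\<close>-seminorm 1, while the hump itself has \<open>Suc i\<close>-seminorm at most
    \<open>(1/2) ^ i\<close>.\<close>
  define c where "c i = 1 / N q ((B ^^ j) (unit_seq (h i)))" for i
  have c_pos: "0 < c i" for i
  proof -
    have "0 \<le> 2 ^ i * N (Suc i) (unit_seq (h i))"
      by (intro mult_nonneg_nonneg N_nonneg unit_seq_X) auto
    then show ?thesis
      unfolding c_def using h(2)[of i] by simp
  qed
  define g where "g i = cscale (c i) (unit_seq (h i))" for i
  have gX: "g i \<in> X" for i
    unfolding g_def by (intro X_scale unit_seq_X)
  have g_bound: "N (Suc i) (g i) \<le> (1/2) ^ i" for i
  proof -
    have "N (Suc i) (g i) = c i * N (Suc i) (unit_seq (h i))"
      unfolding g_def using N_scale[of "Suc i"] unit_seq_X c_pos[of i] by simp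
    moreover have "2 ^ i * N (Suc i) (unit_seq (h i)) * c i \<le> 1"
      using h(2)[of i] c_pos[of i] by (simp add: c_def divide_simps split: if_splits)
    ultimately show ?thesis
      by (simp add: field_simps power_divide)
  qed
  have sm: "summable (\<lambda>i. N r (g i))" if r: "1 \<le> r" for r
  proof (rule summable_comparison_test_ev)
    show "summable (\<lambda>i. (1/2::real) ^ i)" by simp
    have "norm (N r (g i)) \<le> (1/2) ^ i" if "r \<le> i" for i
      using N_mono[OF r _ gX, of "Suc i" i] N_nonneg[OF r gX, of i] g_bound[of i] that by simp
    then show "\<forall>\<^sub>F i in sequentially. norm (N r (g i)) \<le> (1/2) ^ i"
      using eventually_sequentially by blast
  qed
  have g_apply: "g i n = (if h i = n then c i else 0)" for i n
    by (simp add: g_def unit_seq_def)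
  \<comment> \<open>Since \<open>h\<close> is injective, the fibre has at most one element; outside
    the range of \<open>h\<close> the empty sum gives 0.\<close>
  define z :: cseq where "z n = (\<Sum>i | h i = n. c i)" for n
  have z_h: "z (h i) = c i" for i
    by (simp add: z_def strict_mono_eq[OF mono_h])
  have sums: "(\<lambda>i. g i n) sums z n" for n
  proof -
    have "finite {i. h i = n}"
      by (rule finite_subset[of _ "{..n}"]) (auto intro: seq_suble[OF mono_h])
    then have "(\<lambda>i. g i n) sums (\<Sum>i | h i = n. g i n)"
      by (rule sums_finite) (simp add: g_apply)
    then show ?thesis
      by (simp add: z_def g_apply)
  qed
  have "z \<in> X"
    by (rule absolutely_convergent_series(1)[OF gX sm sums])
  then have "(\<lambda>n. N q (cscale ((B ^^ j) z n) (unit_seq n))) \<longlonglongrightarrow> 0"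
    by (intro basis_term_tendsto_0 iterate_X q)
  moreover have "strict_mono (\<lambda>i. h i - j)"
    using h by (intro strict_monoI_Suc) (simp add: diff_less_mono)
  ultimately have "((\<lambda>n. N q (cscale ((B ^^ j) z n) (unit_seq n))) \<circ> (\<lambda>i. h i - j)) \<longlonglongrightarrow> 0"
    by (rule LIMSEQ_subseq_LIMSEQ)
  \<comment> \<open>At position \<open>h i - j\<close> the image of \<open>z\<close> sees the
    \<open>i\<close>-th hump alone, which contradicts the convergence of basis terms to 0.\<close>
  moreover have "N q (cscale ((B ^^ j) z (h i - j)) (unit_seq (h i - j))) = 1" for i
  proof -
    have "cscale ((B ^^ j) z (h i - j)) (unit_seq (h i - j)) = cscale (c i) ((B ^^ j) (unit_seq (h i)))"
      using h(1)[of i] by (simp add: iterate_apply iterate_unit_seq z_h mult.commute)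
    moreover have "N q \<dots> = cmod (c i) * N q ((B ^^ j) (unit_seq (h i)))"
      by (intro N_scale q iterate_X unit_seq_X)
    moreover have "cmod (c i) * N q ((B ^^ j) (unit_seq (h i))) = 1"
      using c_pos[of i] by (simp add: c_def norm_divide)
    ultimately show ?thesis by simp
  qed
  ultimately show False
    by (simp add: o_def LIMSEQ_const_iff)
qed

text \<open>Property A is applied \<open>i\<close> times. After extraction of roots this bounds
  seminorms of unit sequences by arbitrarily small powers of larger seminorms.\<close>

lemma unit_seq_norm_power:
  assumes "1 \<le> q"
  shows "\<exists>r\<ge>1. \<exists>C>0. \<forall>n. N q (unit_seq n) ^ (2 ^ i) \<le> C * N r (unit_seq n)"
  using assms
proof (induction i arbitrary: q)
  case 0
  then show ?case
    by (intro exI[of _ q] conjI exI[of _ 1]) auto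
next
  case (Suc i)
  from property_A Suc.prems obtain r C where r: "1 \<le> r" "0 < C"
      "\<And>n. (N q (unit_seq n))\<^sup>2 \<le> C * N r (unit_seq n)"
    unfolding property_A_def by blast
  from Suc.IH[OF r(1)] obtain r' C' where r': "1 \<le> r'" "0 < C'"
      "\<And>n. N r (unit_seq n) ^ (2 ^ i) \<le> C' * N r' (unit_seq n)"
    by blast
  have "N q (unit_seq n) ^ (2 ^ Suc i) \<le> (C ^ (2 ^ i) * C') * N r' (unit_seq n)" for n
  proof -
    have "N q (unit_seq n) ^ (2 ^ Suc i) = ((N q (unit_seq n))\<^sup>2) ^ (2 ^ i)"
      by (simp add: power_mult)
    also have "\<dots> \<le> (C * N r (unit_seq n)) ^ (2 ^ i)"
      using r(3) by (intro power_mono) auto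
    also have "\<dots> = C ^ (2 ^ i) * N r (unit_seq n) ^ (2 ^ i)"
      by (rule power_mult_distrib)
    also have "\<dots> \<le> C ^ (2 ^ i) * (C' * N r' (unit_seq n))"
      using r'(3) r(2) by (intro mult_left_mono) auto
    finally show ?thesis by (simp add: mult.assoc)
  qed
  moreover have "0 < C ^ (2 ^ i) * C'"
    using r r' by simp
  ultimately show ?case
    using r'(1) by blast
qed

lemma inverse_powr_tendsto_0:
  assumes "0 < \<rho>"
  shows "(\<lambda>k. cmod (inverse (v (p k + n))) powr \<rho>) \<longlonglongrightarrow> 0"
  using assms tendsto_norm_zero[OF inverse_limit[of n]]
  by (intro tendsto_zero_powrI[where b = \<rho>]) auto

text \<open>A larger seminorm absorbs \<open>B ^^ j\<close>. For the exponent
  \<open>(1/2) ^ i\<close>, the \<open>2 ^ i\<close>-th power of the remaining quantity is bounded,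
  by iterated Property A, by a seminorm of the scaled unit sequence, which tends to 0 by hypothesis;
  the root then tends to 0 as well.\<close>

lemma inverse_powr_iterate_tendsto_0:
  assumes \<rho>: "0 < \<rho>" and q: "1 \<le> q"
  shows "(\<lambda>k. cmod (inverse (v (p k + n))) powr \<rho> * N q ((B ^^ j) (unit_seq (p k + n)))) \<longlonglongrightarrow> 0"
proof -
  define a where "a k = cmod (inverse (v (p k + n)))" for k
  define l where "l k = p k + n" for k
  have a_nonneg: "0 \<le> a k" for k
    by (simp add: a_def)
  obtain r C K where r: "1 \<le> r" "0 \<le> C"
      "\<And>l. K \<le> l \<Longrightarrow> N q ((B ^^ j) (unit_seq l)) \<le> C * N r (unit_seq l)"
    using iterate_unit_seq_bound[OF q] by blast
  \<comment> \<open>A dyadic exponent below \<rho> is chosen because the iterated Property A is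
    available for powers \<open>2 ^ i\<close>.\<close>
  obtain i where i: "(1/2) ^ i < \<rho>"
    using real_arch_pow_inv[OF \<rho>, of "1/2"] by auto
  obtain r' C' where r': "1 \<le> r'" "0 < C'" "\<And>n. N r (unit_seq n) ^ (2 ^ i) \<le> C' * N r' (unit_seq n)"
    using unit_seq_norm_power[OF r(1)] by blast
  define b where "b k = a k powr ((1/2) ^ i) * N r (unit_seq (l k))" for k
  have b_nonneg: "0 \<le> b k" for k
    unfolding b_def by (intro mult_nonneg_nonneg N_nonneg r unit_seq_X) auto
  have b_power: "b k ^ (2 ^ i) \<le> C' * N r' (cscale (inverse (v (l k))) (unit_seq (l k)))" for k
  proof -
    have "b k ^ (2 ^ i) = (a k powr ((1/2) ^ i)) ^ (2 ^ i) * N r (unit_seq (l k)) ^ (2 ^ i)"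
      by (simp add: b_def power_mult_distrib)
    also have "(a k powr ((1/2) ^ i)) ^ (2 ^ i) = a k"
      using a_nonneg[of k] by (cases "a k = 0") (simp_all add: powr_power power_divide)
    also have "a k * N r (unit_seq (l k)) ^ (2 ^ i) \<le> a k * (C' * N r' (unit_seq (l k)))"
      using r' a_nonneg by (intro mult_left_mono) auto
    also have "\<dots> = C' * N r' (cscale (inverse (v (l k))) (unit_seq (l k)))"
      using N_scale[OF r'(1) unit_seq_X] by (simp add: a_def l_def)
    finally show ?thesis .
  qed
  have "(\<lambda>k. N r' (cscale (inverse (v (l k))) (unit_seq (l k)) - 0)) \<longlonglongrightarrow> 0"
    unfolding l_def by (intro limitin_norm[OF scaled_unit_limit] X_scale unit_seq_X r'(1))
  then have "(\<lambda>k. C' * N r' (cscale (inverse (v (l k))) (unit_seq (l k)))) \<longlonglongrightarrow> 0"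
    by (intro tendsto_mult_right_zero) simp
  then have "(\<lambda>k. b k ^ (2 ^ i)) \<longlonglongrightarrow> 0"
    using b_power b_nonneg
    by (intro tendsto_sandwich[of "\<lambda>_. 0" "\<lambda>k. b k ^ (2 ^ i)"]) auto
  then have "(\<lambda>k. root (2 ^ i) (b k ^ (2 ^ i))) \<longlonglongrightarrow> root (2 ^ i) 0"
    by (rule tendsto_real_root)
  then have b_lim: "(\<lambda>k. C * b k) \<longlonglongrightarrow> 0"
    using b_nonneg by (intro tendsto_mult_right_zero) (simp add: real_root_power_cancel)
  have "\<forall>\<^sub>F k in sequentially. a k < 1"
    using order_tendstoD(2)[OF tendsto_norm_zero[OF inverse_limit[of n]], of 1] by (simp add: a_def)
  moreover have "\<forall>\<^sub>F k in sequentially. K \<le> l k"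
    unfolding l_def using eventually_ge_at_top[of K]
    by (rule eventually_mono) (rule trans_le_add1[OF order_trans[OF _ seq_suble[OF strict_mono_p]]])
  ultimately have bound: "\<forall>\<^sub>F k in sequentially. a k powr \<rho> * N q ((B ^^ j) (unit_seq (l k))) \<le> C * b k"
  proof eventually_elim
    case (elim k)
    \<comment> \<open>As \<open>a k < 1\<close>, the smaller exponent gives the larger
      power.\<close>
    have "a k powr \<rho> \<le> a k powr ((1/2) ^ i)"
      using elim(1) i a_nonneg[of k] by (cases "a k = 0") (auto intro: powr_mono')
    then have "a k powr \<rho> * N q ((B ^^ j) (unit_seq (l k)))
        \<le> a k powr ((1/2) ^ i) * (C * N r (unit_seq (l k)))"
      using r(3)[OF elim(2)] by (intro mult_mono N_nonneg iterate_X unit_seq_X q) auto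
    then show ?case by (simp add: b_def mult_ac)
  qed
  have "(\<lambda>k. a k powr \<rho> * N q ((B ^^ j) (unit_seq (l k)))) \<longlonglongrightarrow> 0"
  proof (rule tendsto_sandwich[OF _ bound tendsto_const b_lim])
    show "\<forall>\<^sub>F k in sequentially. 0 \<le> a k powr \<rho> * N q ((B ^^ j) (unit_seq (l k)))"
      by (intro always_eventually allI mult_nonneg_nonneg N_nonneg iterate_X unit_seq_X q) auto
  qed
  then show ?thesis
    by (simp add: a_def l_def)
qed

section \<open>Construction of a single block\<close>

lemma cmod_exp_Ln:
  assumes "z \<noteq> 0"
  shows "cmod (exp (complex_of_real t * Ln z)) = cmod z powr t"
  using assms by (simp add: powr_def)

text \<open>The block starts at some \<open>p k\<close>, and \<open>U\<close> is a logarithm of the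
  prescribed values divided by \<open>s\<close>. Then \<open>exp (t U)\<close> has the modulus of
  these values to the power \<open>t / s\<close>, so each requirement holds for all large
  \<open>k\<close> by the limits above, and finitely many of them hold together. The third
  requirement makes generators whose exponent exceeds \<open>s\<close> by \<tau> small on this
  block; the fourth keeps the block itself small under shifts by at most \<open>M\<close>.\<close>

lemma exists_block:
  assumes s: "0 < s" and \<tau>: "0 < \<tau>" and \<epsilon>: "0 < \<epsilon>" and q: "1 \<le> q"
    and y: "\<And>n. n < L \<Longrightarrow> y n \<noteq> 0"
  shows "\<exists>m\<ge>M. \<exists>U :: nat \<Rightarrow> complex.
    (\<forall>n<L. exp (complex_of_real s * U n) = v n * y n / v (m + n)) \<and>
    (\<forall>n<L. Re (U n) \<le> 0) \<and>
    (\<Sum>n<L. cmod (exp (complex_of_real \<tau> * U n)) * (cmod (y n) * N q (unit_seq n))) \<le> \<epsilon> \<and>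
    (\<forall>j\<le>M. (\<Sum>n<L. cmod (exp (complex_of_real \<tau> * U n)) * N q ((B ^^ j) (unit_seq (m + n)))) \<le> \<epsilon>)"
proof -
  define \<rho> where "\<rho> = \<tau> / s"
  have \<rho>: "0 < \<rho>"
    using s \<tau> by (simp add: \<rho>_def)
  define d where "d n = cmod (v n * y n)" for n
  \<comment> \<open>The principal logarithm inverts \<open>exp\<close> at nonzero values only,
    whence the hypothesis that no \<open>y n\<close> vanishes.\<close>
  define U where "U k n = Ln (v n * y n / v (p k + n)) / complex_of_real s" for k n
  have nz: "v n * y n / v (p k + n) \<noteq> 0" if "n < L" for k n
    using that v_nonzero y by simp
  have cmod_U: "cmod (exp (complex_of_real t * U k n))
      = d n powr (t / s) * cmod (inverse (v (p k + n))) powr (t / s)" if "n < L" for t k n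
  proof -
    have "complex_of_real t * U k n = complex_of_real (t / s) * Ln (v n * y n / v (p k + n))"
      by (simp add: U_def)
    then have "cmod (exp (complex_of_real t * U k n)) = cmod (v n * y n / v (p k + n)) powr (t / s)"
      by (simp only: cmod_exp_Ln[OF nz[OF that]])
    also have "cmod (v n * y n / v (p k + n)) = d n * cmod (inverse (v (p k + n)))"
      by (simp add: d_def norm_divide norm_mult norm_inverse divide_simps)
    also have "\<dots> powr (t / s) = d n powr (t / s) * cmod (inverse (v (p k + n))) powr (t / s)"
      by (rule powr_mult)
    finally show ?thesis .
  qed
  have "(\<lambda>k. \<Sum>n<L. d n powr \<rho> * cmod (inverse (v (p k + n))) powr \<rho> * (cmod (y n) * N q (unit_seq n)))
      \<longlonglongrightarrow> (\<Sum>n<L. d n powr \<rho> * 0 * (cmod (y n) * N q (unit_seq n)))"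
    by (intro tendsto_sum tendsto_mult tendsto_const inverse_powr_tendsto_0 \<rho>)
  then have ev1: "\<forall>\<^sub>F k in sequentially.
      (\<Sum>n<L. d n powr \<rho> * cmod (inverse (v (p k + n))) powr \<rho> * (cmod (y n) * N q (unit_seq n))) < \<epsilon>"
    using \<epsilon> by (intro order_tendstoD(2)) auto
  have "(\<lambda>k. \<Sum>n<L. d n powr \<rho> * (cmod (inverse (v (p k + n))) powr \<rho> * N q ((B ^^ j) (unit_seq (p k + n)))))
      \<longlonglongrightarrow> (\<Sum>n<L. d n powr \<rho> * 0)" for j
    by (intro tendsto_sum tendsto_mult tendsto_const inverse_powr_iterate_tendsto_0 \<rho> q)
  then have "\<forall>\<^sub>F k in sequentially.
      (\<Sum>n<L. d n powr \<rho> * (cmod (inverse (v (p k + n))) powr \<rho> * N q ((B ^^ j) (unit_seq (p k + n))))) < \<epsilon>" for j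
    using \<epsilon> by (intro order_tendstoD(2)) auto
  then have ev2: "\<forall>\<^sub>F k in sequentially. \<forall>j\<in>{..M}.
      (\<Sum>n<L. d n powr \<rho> * (cmod (inverse (v (p k + n))) powr \<rho> * N q ((B ^^ j) (unit_seq (p k + n))))) < \<epsilon>"
    by (intro eventually_ball_finite) auto
  have "(\<lambda>k. d n powr (1 / s) * cmod (inverse (v (p k + n))) powr (1 / s)) \<longlonglongrightarrow> 0" for n
    using inverse_powr_tendsto_0[of "1 / s" n] s by (intro tendsto_mult_right_zero) auto
  then have "\<forall>\<^sub>F k in sequentially. d n powr (1 / s) * cmod (inverse (v (p k + n))) powr (1 / s) < 1" for n
    by (intro order_tendstoD(2)) auto
  then have ev3: "\<forall>\<^sub>F k in sequentially.
      \<forall>n\<in>{..<L}. d n powr (1 / s) * cmod (inverse (v (p k + n))) powr (1 / s) < 1"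
    by (intro eventually_ball_finite) auto
  have ev4: "\<forall>\<^sub>F k in sequentially. M \<le> p k"
    using eventually_ge_at_top[of M]
    by (rule eventually_mono) (rule order_trans[OF _ seq_suble[OF strict_mono_p]])
  from eventually_happens[OF eventually_conj[OF ev1 eventually_conj[OF ev2 eventually_conj[OF ev3 ev4]]]]
  obtain k where k: "M \<le> p k"
      "(\<Sum>n<L. d n powr \<rho> * cmod (inverse (v (p k + n))) powr \<rho> * (cmod (y n) * N q (unit_seq n))) < \<epsilon>"
      "\<And>j. j \<le> M \<Longrightarrow>
        (\<Sum>n<L. d n powr \<rho> * (cmod (inverse (v (p k + n))) powr \<rho> * N q ((B ^^ j) (unit_seq (p k + n))))) < \<epsilon>"
      "\<And>n. n < L \<Longrightarrow> d n powr (1 / s) * cmod (inverse (v (p k + n))) powr (1 / s) < 1"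
    by auto
  show ?thesis
  proof (intro exI[of _ "p k"] conjI exI[of _ "U k"] allI impI)
    show "M \<le> p k" by fact
    show "exp (complex_of_real s * U k n) = v n * y n / v (p k + n)" if "n < L" for n
      using s nz[OF that] by (simp add: U_def)
    show "Re (U k n) \<le> 0" if "n < L" for n
    proof -
      have "exp (Re (U k n)) < 1"
        using cmod_U[OF that, of 1 k] k(4)[OF that] by simp
      then show ?thesis by simp
    qed
    show "(\<Sum>n<L. cmod (exp (complex_of_real \<tau> * U k n)) * (cmod (y n) * N q (unit_seq n))) \<le> \<epsilon>"
    proof -
      have "(\<Sum>n<L. cmod (exp (complex_of_real \<tau> * U k n)) * (cmod (y n) * N q (unit_seq n)))
          = (\<Sum>n<L. d n powr \<rho> * cmod (inverse (v (p k + n))) powr \<rho> * (cmod (y n) * N q (unit_seq n)))"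
        by (intro sum.cong refl) (simp only: cmod_U \<rho>_def lessThan_iff)
      then show ?thesis using k(2) by linarith
    qed
    show "(\<Sum>n<L. cmod (exp (complex_of_real \<tau> * U k n)) * N q ((B ^^ j) (unit_seq (p k + n)))) \<le> \<epsilon>"
      if "j \<le> M" for j
    proof -
      have "(\<Sum>n<L. cmod (exp (complex_of_real \<tau> * U k n)) * N q ((B ^^ j) (unit_seq (p k + n))))
          = (\<Sum>n<L. d n powr \<rho> * (cmod (inverse (v (p k + n))) powr \<rho> * N q ((B ^^ j) (unit_seq (p k + n)))))"
        by (intro sum.cong refl) (simp only: cmod_U \<rho>_def lessThan_iff mult.assoc)
      then show ?thesis using k(3)[OF that] by linarith
    qed
  qed
qed

end

section \<open>Block sequences and their orbits\<close>

text \<open>Block \<open>b\<close> has start \<open>m b\<close>, length \<open>L b\<close>, exponent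
  \<open>s b\<close> and target \<open>y b\<close>. The threshold \<open>1 / Suc b\<close> decreases
  to 0 and the index \<open>Suc b\<close> grows, so every positive exponent, every positive gap
  between exponents and every seminorm is covered from some block on. The case \<open>j = 0\<close>
  serves membership of the generators in \<open>X\<close>; the shifts \<open>m a\<close> serve their
  orbits.\<close>

locale hypercyclic_blocks = backward_shift_algebra +
  fixes s :: "nat \<Rightarrow> real" and L m :: "nat \<Rightarrow> nat" and y U :: "nat \<Rightarrow> nat \<Rightarrow> complex"
  assumes blocks_ordered: "\<And>b. m b + L b \<le> m (Suc b)"
    and exp_target: "\<And>b n. n < L b \<Longrightarrow> exp (complex_of_real (s b) * U b n) = v n * y b n / v (m b + n)"
    and Re_U: "\<And>b n. n < L b \<Longrightarrow> Re (U b n) \<le> 0"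
    and small_on_own_block: "\<And>b. (\<Sum>n<L b. cmod (exp (complex_of_real (1 / Suc b) * U b n)) *
      (cmod (y b n) * N (Suc b) (unit_seq n))) \<le> (1/2) ^ b"
    and small_after_earlier_shift: "\<And>b j. j = 0 \<or> (\<exists>a<b. j = m a) \<Longrightarrow>
      (\<Sum>n<L b. cmod (exp (complex_of_real (1 / Suc b) * U b n)) *
        N (Suc b) ((B ^^ j) (unit_seq (m b + n)))) \<le> (1/2) ^ b"
begin

definition block :: "nat \<Rightarrow> nat set" where
  "block b = {m b..<m b + L b}"

text \<open>The description picks out a unique block because the blocks are pairwise
  disjoint.\<close>

definition gen :: "real \<Rightarrow> cseq" where
  "gen t l = (if \<exists>b. l \<in> block b
    then let b = THE b. l \<in> block b in exp (complex_of_real t * U b (l - m b)) else 0)"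

text \<open>This is the restriction of \<open>gen t\<close> to block \<open>b\<close>, written as a
  finite combination of unit sequences so that seminorms can be estimated term by term.\<close>

definition piece :: "real \<Rightarrow> nat \<Rightarrow> cseq" where
  "piece t b = (\<Sum>n<L b. cscale (exp (complex_of_real t * U b n)) (unit_seq (m b + n)))"

lemma block_end_le: "a < b \<Longrightarrow> m a + L a \<le> m b"
proof (induction b)
  case (Suc b)
  then show ?case
    using blocks_ordered[of b] by (cases "a = b") auto
qed simp

lemma block_disjoint: "l \<in> block a \<Longrightarrow> l \<in> block b \<Longrightarrow> a = b"
  using block_end_le[of a b] block_end_le[of b a]
  by (cases a b rule: linorder_cases) (auto simp: block_def)

lemma the_block: "l \<in> block b \<Longrightarrow> (THE b. l \<in> block b) = b"
  using block_disjoint by blast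

lemma gen_on_block: "l \<in> block b \<Longrightarrow> gen t l = exp (complex_of_real t * U b (l - m b))"
  by (auto simp: gen_def the_block)

lemma gen_off_blocks: "(\<And>b. l \<notin> block b) \<Longrightarrow> gen t l = 0"
  by (simp add: gen_def)

text \<open>The functional equation of \<open>exp\<close> holds on each block, and the cut-off is
  idempotent.\<close>

lemma gen_mult: "gen t * gen t' = gen (t + t')"
proof
  fix l
  show "(gen t * gen t') l = gen (t + t') l"
  proof (cases "\<exists>b. l \<in> block b")
    case True
    then obtain b where "l \<in> block b" by blast
    then show ?thesis
      by (simp add: gen_on_block exp_add[symmetric] distrib_right)
  next
    case False
    then show ?thesis
      by (simp add: gen_off_blocks)
  qed
qed

lemma piece_apply: "piece t b l = (if l \<in> block b then gen t l else 0)"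
proof (cases "l \<in> block b")
  case True
  then obtain n where n: "n < L b" "l = m b + n"
    unfolding block_def by (metis add_less_cancel_left atLeastLessThan_iff le_Suc_ex)
  have "piece t b l = (\<Sum>k<L b. if k = n then exp (complex_of_real t * U b k) else 0)"
    unfolding piece_def sum_seq_apply using n by (intro sum.cong) (auto simp: unit_seq_def)
  also have "\<dots> = exp (complex_of_real t * U b n)"
    using n by simp
  finally show ?thesis
    using True n by (simp add: gen_on_block)
next
  case False
  then have "piece t b l = 0"
    unfolding piece_def sum_seq_apply
    by (intro sum.neutral) (auto simp: unit_seq_def block_def)
  with False show ?thesis by simp
qed

section \<open>Norm estimates for generators and their orbits\<close>

lemma piece_X: "piece t b \<in> X"
  unfolding piece_def by (intro X_sum X_scale unit_seq_X)

lemma piece_sums: "(\<lambda>b. piece t b l) sums gen t l"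
proof (cases "\<exists>b. l \<in> block b")
  case True
  then obtain b where b: "l \<in> block b" by blast
  have "(\<lambda>a. piece t a l) sums (\<Sum>a\<in>{b}. piece t a l)"
    using block_disjoint[OF b] by (intro sums_finite) (auto simp: piece_apply)
  then show ?thesis
    using b by (simp add: piece_apply)
next
  case False
  then show ?thesis
    by (simp add: piece_apply gen_off_blocks)
qed

text \<open>Because \<open>U\<close> has non-positive real part, a bound at the threshold exponent
  \<open>1 / Suc b\<close> passes to all larger exponents.\<close>

lemma cmod_exp_antimono:
  assumes "t \<le> t'" "n < L b"
  shows "cmod (exp (complex_of_real t' * U b n)) \<le> cmod (exp (complex_of_real t * U b n))"
  using mult_right_mono_neg[OF assms(1) Re_U[OF assms(2)]] by simp

lemma N_iterate_piece_le:
  assumes t: "1 / Suc b \<le> t" and q: "1 \<le> q" "q \<le> Suc b" and j: "j = 0 \<or> (\<exists>a<b. j = m a)"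
  shows "N q ((B ^^ j) (piece t b)) \<le> (1/2) ^ b"
proof -
  have "N q ((B ^^ j) (piece t b))
      \<le> (\<Sum>n<L b. N q (cscale (exp (complex_of_real t * U b n)) ((B ^^ j) (unit_seq (m b + n)))))"
    unfolding piece_def iterate_sum by (intro N_sum_le q X_scale iterate_X unit_seq_X)
  also have "\<dots> = (\<Sum>n<L b. cmod (exp (complex_of_real t * U b n)) * N q ((B ^^ j) (unit_seq (m b + n))))"
    by (intro sum.cong refl N_scale q iterate_X unit_seq_X)
  also have "\<dots> \<le> (\<Sum>n<L b. cmod (exp (complex_of_real (1 / Suc b) * U b n)) *
      N (Suc b) ((B ^^ j) (unit_seq (m b + n))))"
    by (intro sum_mono mult_mono cmod_exp_antimono t N_mono q N_nonneg iterate_X unit_seq_X norm_ge_zero)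
      auto
  also have "\<dots> \<le> (1/2) ^ b"
    by (rule small_after_earlier_shift[OF j])
  finally show ?thesis .
qed

text \<open>The shift \<open>j\<close> and the first block \<open>K\<close> are kept general for two
  uses: \<open>j = 0\<close>, \<open>K = 0\<close> puts the generators into \<open>X\<close>, while
  \<open>j = m b\<close>, \<open>K = Suc b\<close> estimates what lies behind block
  \<open>b\<close>. In both, the pieces are dominated by a geometric series. Summability tolerates
  finitely many uncontrolled pieces; the norm bound needs control from block \<open>K\<close>
  on.\<close>

lemma tail_in_X:
  assumes t: "0 < t" and j: "\<And>b. K \<le> b \<Longrightarrow> j = 0 \<or> (\<exists>a<b. j = m a)"
    and z: "\<And>n. (\<lambda>i. (B ^^ j) (piece t (K + i)) n) sums z n"
  shows "z \<in> X"
    and "1 / Suc K \<le> t \<Longrightarrow> 1 \<le> q \<Longrightarrow> q \<le> Suc K \<Longrightarrow> N q z \<le> 2 * (1/2) ^ K"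
proof -
  have gX: "(B ^^ j) (piece t (K + i)) \<in> X" for i
    by (intro iterate_X piece_X)
  have le: "norm (N q ((B ^^ j) (piece t (K + i)))) \<le> (1/2) ^ K * (1/2) ^ i"
    if "1 / Suc (K + i) \<le> t" "1 \<le> q" "q \<le> Suc (K + i)" for q i
    using N_iterate_piece_le[OF that j] N_nonneg[OF that(2) gX[of i]]
    by (simp only: real_norm_def abs_of_nonneg power_add le_add1)
  have geo: "(\<lambda>i. (1/2::real) ^ K * (1/2) ^ i) sums ((1/2) ^ K * 2)"
    using sums_mult[OF geometric_sums[of "1/2::real"], of "(1/2) ^ K"] by simp
  obtain M where M: "inverse (real (Suc M)) < t"
    using reals_Archimedean[OF t] by blast
  have sm: "summable (\<lambda>i. N q ((B ^^ j) (piece t (K + i))))" if q: "1 \<le> q" for q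
  proof (rule summable_comparison_test[OF _ sums_summable[OF geo]])
    \<comment> \<open>From \<open>q + M\<close> on, both the threshold exponent lies below
      \<open>t\<close> and the block's seminorm index exceeds \<open>q\<close>.\<close>
    have "norm (N q ((B ^^ j) (piece t (K + i)))) \<le> (1/2) ^ K * (1/2) ^ i" if "q + M \<le> i" for i
    proof (rule le[OF _ q])
      have "1 / real (Suc (K + i)) \<le> inverse (real (Suc M))"
        using that by (simp add: divide_simps)
      then show "1 / real (Suc (K + i)) \<le> t"
        using M by linarith
    qed (use that in simp)
    then show "\<exists>N'. \<forall>i\<ge>N'. norm (N q ((B ^^ j) (piece t (K + i)))) \<le> (1/2) ^ K * (1/2) ^ i"
      by blast
  qed
  show "z \<in> X"
    by (rule absolutely_convergent_series(1)[OF gX sm z])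
  assume tK: "1 / Suc K \<le> t" and q: "1 \<le> q" "q \<le> Suc K"
  have "N q z \<le> (\<Sum>i. N q ((B ^^ j) (piece t (K + i))))"
    by (rule absolutely_convergent_series(2)[OF gX sm z q(1)])
  also have "\<dots> \<le> (\<Sum>i. (1/2) ^ K * (1/2) ^ i)"
  proof (rule suminf_le[OF _ sm[OF q(1)] sums_summable[OF geo]])
    fix i
    have "1 / real (Suc (K + i)) \<le> 1 / real (Suc K)"
      by (simp add: divide_simps)
    then show "N q ((B ^^ j) (piece t (K + i))) \<le> (1/2) ^ K * (1/2) ^ i"
      using le[of i q] tK q by simp
  qed
  also have "\<dots> = 2 * (1/2) ^ K"
    using sums_unique[OF geo] by simp
  finally show "N q z \<le> 2 * (1/2) ^ K" .
qed

lemma gen_X: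
  assumes "0 < t"
  shows "gen t \<in> X"
  by (rule tail_in_X(1)[OF assms, of 0 0]) (auto simp: piece_sums)

text \<open>The shift by \<open>m b\<close> deletes the blocks before \<open>b\<close> and turns
  block \<open>b\<close> into \<open>y b\<close> multiplied by \<open>exp ((t - s b) U)\<close>.
  This factor is 1 if \<open>t = s b\<close> and makes the result small if \<open>t\<close> exceeds
  \<open>s b\<close> by the threshold; for \<open>t < s b\<close> its modulus would be at least 1.
  The later blocks add a small tail.\<close>

lemma gen_orbit_estimate:
  assumes t: "t = s b \<or> s b + 1 / Suc b \<le> t" "1 / Suc b \<le> t" and q: "1 \<le> q" "q \<le> Suc b"
  shows "N q ((B ^^ m b) (gen t) - (if t = s b then \<Sum>n<L b. cscale (y b n) (unit_seq n) else 0))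
    \<le> 2 * (1/2) ^ b"
proof -
  let ?Y = "if t = s b then \<Sum>n<L b. cscale (y b n) (unit_seq n) else 0"
  have "0 < 1 / real (Suc b)" by simp
  then have t_pos: "0 < t"
    using t(2) by linarith
  \<comment> \<open>The contribution of the blocks after \<open>b\<close>: those before
    \<open>b\<close> vanish under the shift.\<close>
  define z where "z = (B ^^ m b) (gen t) - (B ^^ m b) (piece t b)"
  have "(\<lambda>i. (B ^^ m b) (piece t (Suc b + i)) n) sums z n" for n
  proof -
    \<comment> \<open>Blocks before \<open>b\<close> end at or before \<open>m b\<close>, so they do
      not meet the positions \<open>m b + n\<close>.\<close>
    have "(\<Sum>a<Suc b. piece t a (m b + n)) = piece t b (m b + n)"
      using block_end_le[of _ b] by (fastforce simp: piece_apply block_def intro: sum.neutral)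
    then have "(\<lambda>i. piece t (i + Suc b) (m b + n)) sums (gen t (m b + n) - piece t b (m b + n))"
      using sums_split_initial_segment[OF piece_sums, of t "Suc b" "m b + n"] by simp
    then show ?thesis
      unfolding z_def minus_apply iterate_apply
      by (subst right_diff_distrib[symmetric], intro sums_mult) (simp only: add.commute[of "Suc b"])
  qed
  note tail = tail_in_X[OF t_pos _ this]
  have earlier: "m b = 0 \<or> (\<exists>a<c. m b = m a)" if "Suc b \<le> c" for c
    using that by (intro disjI2 exI[of _ b]) simp
  have z_X: "z \<in> X"
    by (rule tail(1)[OF earlier])
  \<comment> \<open>The tail starts at block \<open>Suc b\<close>, which absorbs the factor 2 of the
    geometric series.\<close>
  have "N q z \<le> 2 * (1/2) ^ Suc b" if "1 / Suc (Suc b) \<le> t"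
    using tail(2)[OF earlier that q(1)] q(2) by simp
  moreover have "1 / real (Suc (Suc b)) \<le> 1 / real (Suc b)"
    by (simp add: divide_simps)
  ultimately have z_le: "N q z \<le> (1/2) ^ b"
    using t(2) by simp
  have own: "(B ^^ m b) (piece t b)
      = (\<Sum>n<L b. cscale (exp (complex_of_real (t - s b) * U b n) * y b n) (unit_seq n))"
    unfolding piece_def iterate_sum
  proof (intro sum.cong refl)
    fix n assume "n \<in> {..<L b}"
    then have n: "n < L b" by simp
    \<comment> \<open>Splitting off the exponent \<open>s b\<close> brings in the prescribed values,
      whose quotient of \<open>v\<close> cancels the weight factor of the iterate.\<close>
    have "exp (complex_of_real (t - s b) * U b n) * exp (complex_of_real (s b) * U b n)
        = exp (complex_of_real t * U b n)"
      by (simp add: exp_add[symmetric] algebra_simps)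
    then have "exp (complex_of_real (t - s b) * U b n) * (v n * y b n / v (m b + n)) = exp (complex_of_real t * U b n)"
      unfolding exp_target[OF n] .
    then have "exp (complex_of_real t * U b n) * (v (m b + n) / v n)
        = exp (complex_of_real (t - s b) * U b n) * y b n"
      using v_nonzero by (auto simp: field_simps)
    then show "cscale (exp (complex_of_real t * U b n)) ((B ^^ m b) (unit_seq (m b + n)))
        = cscale (exp (complex_of_real (t - s b) * U b n) * y b n) (unit_seq n)"
      by (simp add: iterate_unit_seq)
  qed
  have own_le: "N q ((B ^^ m b) (piece t b) - ?Y) \<le> (1/2) ^ b"
  proof (cases "t = s b")
    case True
    then show ?thesis
      unfolding own using N_zero[OF q(1)] by simp
  next
    case False
    then have ts: "1 / Suc b \<le> t - s b"
      using t(1) by linarith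
    have "N q ((B ^^ m b) (piece t b))
        \<le> (\<Sum>n<L b. N q (cscale (exp (complex_of_real (t - s b) * U b n) * y b n) (unit_seq n)))"
      unfolding own by (intro N_sum_le q X_scale unit_seq_X)
    also have "\<dots> = (\<Sum>n<L b. cmod (exp (complex_of_real (t - s b) * U b n)) * (cmod (y b n) * N q (unit_seq n)))"
      by (intro sum.cong refl) (simp only: N_scale[OF q(1) unit_seq_X] norm_mult mult.assoc)
    also have "\<dots> \<le> (\<Sum>n<L b. cmod (exp (complex_of_real (1 / Suc b) * U b n)) *
        (cmod (y b n) * N (Suc b) (unit_seq n)))"
      by (intro sum_mono mult_mono cmod_exp_antimono ts N_mono q N_nonneg unit_seq_X norm_ge_zero
          mult_nonneg_nonneg order_refl) auto
    also have "\<dots> \<le> (1/2) ^ b"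
      by (rule small_on_own_block)
    finally show ?thesis
      using False by simp
  qed
  have Y_X: "?Y \<in> X"
    using X_zero by (simp add: partial_sum_X)
  have split: "(B ^^ m b) (gen t) - ?Y = z + ((B ^^ m b) (piece t b) - ?Y)"
    by (simp add: z_def)
  have "N q (z + ((B ^^ m b) (piece t b) - ?Y)) \<le> N q z + N q ((B ^^ m b) (piece t b) - ?Y)"
    by (intro N_triangle q z_X X_diff Y_X iterate_X piece_X)
  then show ?thesis
    unfolding split using z_le own_le by linarith
qed

end

section \<open>Choice of the blocks\<close>

text \<open>Targets must be nonzero in order to have logarithms. Removing 0 from a countable dense
  set preserves density, as a ball without 0 is still open and nonempty.\<close>

lemma dense_nonzero_complex_sequence:
  obtains d :: "nat \<Rightarrow> complex"
  where "\<And>n. d n \<noteq> 0" "\<And>z \<epsilon>. 0 < \<epsilon> \<Longrightarrow> \<exists>n. cmod (d n - z) < \<epsilon>"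
proof -
  obtain D :: "complex set" where D: "countable D" "\<And>S. open S \<Longrightarrow> S \<noteq> {} \<Longrightarrow> \<exists>d\<in>D. d \<in> S"
    using countable_dense_setE by blast
  have dense: "\<exists>d\<in>D - {0}. cmod (d - z) < \<epsilon>" if \<epsilon>: "0 < \<epsilon>" for z and \<epsilon> :: real
  proof -
    have "ball z \<epsilon> - {0} \<noteq> {}"
    proof
      assume "ball z \<epsilon> - {0} = {}"
      moreover from \<epsilon> have "z \<in> ball z \<epsilon>" "z + complex_of_real (\<epsilon> / 2) \<in> ball z \<epsilon>"
        by (auto simp: dist_norm)
      ultimately have "z = 0" "z + complex_of_real (\<epsilon> / 2) = 0"
        by blast+
      with \<epsilon> show False
        by simp
    qed
    then obtain d where "d \<in> D" "d \<in> ball z \<epsilon> - {0}"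
      using D(2)[of "ball z \<epsilon> - {0}"] by blast
    then show ?thesis
      by (intro bexI[of _ d]) (auto simp: dist_norm norm_minus_commute)
  qed
  have ne: "D - {0} \<noteq> {}"
    using dense[OF zero_less_one] by blast
  let ?d = "from_nat_into (D - {0})"
  have "?d n \<noteq> 0" for n
    using from_nat_into[OF ne, of n] by simp
  moreover have "\<exists>n. cmod (?d n - z) < \<epsilon>" if "0 < \<epsilon>" for z \<epsilon>
  proof -
    obtain d where d: "d \<in> D - {0}" "cmod (d - z) < \<epsilon>"
      using dense[OF \<open>0 < \<epsilon>\<close>] by blast
    obtain n where "?d n = d"
      using from_nat_into_surj[OF countable_Diff[OF D(1)] d(1)] by blast
    with d(2) show ?thesis by blast
  qed
  ultimately show thesis
    by (rule that)
qed

text \<open>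
  Every target occurs infinitely often, thanks to a dummy third component of the decoded index.
\<close>

lemma exists_target_enumeration:
  obtains s :: "nat \<Rightarrow> real" and L :: "nat \<Rightarrow> nat" and y :: "nat \<Rightarrow> nat \<Rightarrow> complex"
  where "\<And>b. 0 < s b" "\<And>b n. y b n \<noteq> 0"
    "\<And>t M z \<epsilon> b\<^sub>0. 0 < t \<Longrightarrow> t \<in> \<rat> \<Longrightarrow> 0 < \<epsilon> \<Longrightarrow>
      \<exists>b\<ge>b\<^sub>0. s b = t \<and> L b = M \<and> (\<forall>n<M. cmod (y b n - z n) < \<epsilon>)"
proof -
  obtain d :: "nat \<Rightarrow> complex"
    where d: "\<And>n. d n \<noteq> 0" "\<And>z \<epsilon>. 0 < \<epsilon> \<Longrightarrow> \<exists>n. cmod (d n - z) < \<epsilon>"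
    using dense_nonzero_complex_sequence by blast
  \<comment> \<open>An index codes a rational exponent, a list of positions in \<open>d\<close>
    whose length is the block length, and a dummy number.\<close>
  define dec :: "nat \<Rightarrow> rat \<times> nat list \<times> nat" where "dec = from_nat"
  \<comment> \<open>The default 1 keeps the exponent positive when the decoded rational is
    not.\<close>
  define s :: "nat \<Rightarrow> real" where "s b = (if 0 < fst (dec b) then of_rat (fst (dec b)) else 1)" for b
  define L where "L b = length (fst (snd (dec b)))" for b
  \<comment> \<open>Beyond the end of the list the position is unspecified, but the value of
    \<open>d\<close> there is still nonzero.\<close>
  define y where "y b n = d (fst (snd (dec b)) ! n)" for b n
  have "0 < s b" for b
    by (simp add: s_def)
  moreover have "y b n \<noteq> 0" for b n
    by (simp add: y_def d)
  moreover have "\<exists>b\<ge>b\<^sub>0. s b = t \<and> L b = M \<and> (\<forall>n<M. cmod (y b n - z n) < \<epsilon>)"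
    if t: "0 < t" "t \<in> \<rat>" and \<epsilon>: "0 < \<epsilon>" for t M z \<epsilon> b\<^sub>0
  proof -
    obtain r where r: "t = of_rat r"
      using t(2) by (rule Rats_cases)
    have "\<forall>n. \<exists>k. cmod (d k - z n) < \<epsilon>"
      using d(2)[OF \<epsilon>] by blast
    then obtain h where h: "\<And>n. cmod (d (h n) - z n) < \<epsilon>"
      unfolding choice_iff by blast
    \<comment> \<open>Varying the dummy component yields infinitely many codes of one target, hence
      codes beyond \<open>b\<^sub>0\<close>.\<close>
    define f where "f k = to_nat (r, map h [0..<M], k :: nat)" for k
    have "inj f"
      by (auto simp: inj_def f_def)
    then have "infinite (range f)"
      by (rule range_inj_infinite)
    then obtain b where b: "b\<^sub>0 \<le> b" "b \<in> range f"
      unfolding infinite_nat_iff_unbounded_le by blast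
    then obtain k where "dec b = (r, map h [0..<M], k)"
      by (auto simp: f_def dec_def)
    then show ?thesis
      using b(1) t r h by (intro exI[of _ b]) (auto simp: s_def L_def y_def)
  qed
  ultimately show thesis
    by (rule that)
qed

text \<open>The blocks are chosen recursively, with the end of the previous block as the bound
  \<open>M\<close> for the next one. This orders the blocks and covers the shifts by all earlier
  starting points at once.\<close>

lemma (in backward_shift_algebra) exists_hypercyclic_blocks:
  assumes s: "\<And>b. 0 < s b" and y: "\<And>b n. y b n \<noteq> 0"
  obtains m U where "hypercyclic_blocks X N w v p s L m y U"
proof -
  define P where "P b M mU \<longleftrightarrow>
    (\<forall>n<L b. exp (complex_of_real (s b) * snd mU n) = v n * y b n / v (fst mU + n)) \<and>
    (\<forall>n<L b. Re (snd mU n) \<le> 0) \<and>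
    (\<Sum>n<L b. cmod (exp (complex_of_real (1 / Suc b) * snd mU n)) * (cmod (y b n) * N (Suc b) (unit_seq n)))
      \<le> (1/2) ^ b \<and>
    (\<forall>j\<le>M. (\<Sum>n<L b. cmod (exp (complex_of_real (1 / Suc b) * snd mU n)) *
      N (Suc b) ((B ^^ j) (unit_seq (fst mU + n)))) \<le> (1/2) ^ b)"
    for b M and mU :: "nat \<times> (nat \<Rightarrow> complex)"
  have ex: "\<exists>mU. P b M mU \<and> M \<le> fst mU" for b M
    using exists_block[where s = "s b" and \<tau> = "1 / Suc b" and \<epsilon> = "(1/2) ^ b" and q = "Suc b"
        and y = "y b" and L = "L b" and M = M] s y
    by (auto simp: P_def)
  have P_0: "P b 0 mU" if "P b M mU" for b M mU
    using that unfolding P_def by blast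
  \<comment> \<open>The invariant \<open>P b 0\<close> mentions block \<open>b\<close> alone;
    whatever depends on the predecessor is placed in the relation between consecutive
    choices.\<close>
  have "\<exists>f. \<forall>b. P b 0 (f b) \<and> (fst (f b) + L b \<le> fst (f (Suc b)) \<and> P (Suc b) (fst (f b) + L b) (f (Suc b)))"
  proof (rule dependent_nat_choice)
    show "\<exists>x. P 0 0 x"
      using ex by blast
    show "\<exists>x'. P (Suc b) 0 x' \<and> (fst x + L b \<le> fst x' \<and> P (Suc b) (fst x + L b) x')" for x b
      using ex[of "Suc b" "fst x + L b"] P_0 by blast
  qed
  then obtain f where f: "\<And>b. P b 0 (f b)" "\<And>b. fst (f b) + L b \<le> fst (f (Suc b))"
      "\<And>b. P (Suc b) (fst (f b) + L b) (f (Suc b))"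
    by blast
  define m U where "m b = fst (f b)" and "U b = snd (f b)" for b
  have m_mono: "m a \<le> m b" if "a \<le> b" for a b
  proof (rule lift_Suc_mono_le[OF _ that])
    show "m c \<le> m (Suc c)" for c
      using f(2)[of c] by (simp add: m_def)
  qed
  have "hypercyclic_blocks X N w v p s L m y U"
  proof unfold_locales
    show "m b + L b \<le> m (Suc b)" for b
      using f(2) by (simp add: m_def)
    show "exp (complex_of_real (s b) * U b n) = v n * y b n / v (m b + n)" "Re (U b n) \<le> 0"
      if "n < L b" for b n
      using f(1)[of b] that by (auto simp: P_def m_def U_def)
    show "(\<Sum>n<L b. cmod (exp (complex_of_real (1 / Suc b) * U b n)) *
      (cmod (y b n) * N (Suc b) (unit_seq n))) \<le> (1/2) ^ b" for b
      using f(1)[of b] unfolding P_def m_def U_def by (elim conjE)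
    show "(\<Sum>n<L b. cmod (exp (complex_of_real (1 / Suc b) * U b n)) *
        N (Suc b) ((B ^^ j) (unit_seq (m b + n)))) \<le> (1/2) ^ b"
      if j: "j = 0 \<or> (\<exists>a<b. j = m a)" for b j
    proof (cases "j = 0")
      case True
      then show ?thesis
        using f(1)[of b] unfolding P_def m_def U_def by blast
    next
      case False
      then obtain a where a: "a < b" "j = m a"
        using j by blast
      then obtain c where c: "b = Suc c" "a \<le> c"
        by (metis less_Suc_eq_le less_imp_Suc_add)
      \<comment> \<open>Every earlier starting point is at most the end of the preceding block, so
        it lies in the range of shifts controlled by \<open>P\<close>.\<close>
      then have "j \<le> fst (f c) + L c"
        using m_mono[OF c(2)] a by (simp add: m_def)
      then show ?thesis
        using f(3)[of c] unfolding P_def m_def U_def c(1) by blast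
    qed
  qed
  then show thesis
    by (rule that)
qed

section \<open>The algebra of hypercyclic vectors\<close>

context hypercyclic_blocks
begin

lemma combination_X:
  assumes "\<And>t. t \<in> F \<Longrightarrow> 0 < t"
  shows "(\<Sum>t\<in>F. cscale (a t) (gen t)) \<in> X"
  using assms by (intro X_sum X_scale gen_X)

text \<open>Once \<open>1 / Suc b\<close> lies below \<open>Min F\<close> and below all gaps
  \<open>t - Min F\<close>, the estimate for single generators applies to every \<open>t\<close> in
  \<open>F\<close>. On blocks made for \<open>Min F\<close> only the term of smallest exponent
  leaves a target.\<close>

lemma combination_orbit_estimate:
  assumes F: "finite F" "F \<noteq> {}" "F \<subseteq> {0<..}" and q: "1 \<le> q"
  shows "\<forall>\<^sub>F b in sequentially. s b = Min F \<longrightarrow>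
    N q ((B ^^ m b) (\<Sum>t\<in>F. cscale (a t) (gen t)) - cscale (a (Min F)) (\<Sum>n<L b. cscale (y b n) (unit_seq n)))
      \<le> (\<Sum>t\<in>F. cmod (a t)) * 2 * (1/2) ^ b"
proof -
  have small: "\<forall>\<^sub>F b in sequentially. 1 / real (Suc b) < c" if "0 < c" for c :: real
    using order_tendstoD(2)[OF LIMSEQ_inverse_real_of_nat that] by (simp add: inverse_eq_divide)
  have "\<forall>\<^sub>F b in sequentially. \<forall>t\<in>F. t \<noteq> Min F \<longrightarrow> 1 / real (Suc b) < t - Min F"
  proof (intro eventually_ball_finite F ballI)
    fix t assume "t \<in> F"
    then have "t \<noteq> Min F \<Longrightarrow> 0 < t - Min F"
      using Min_le[OF F(1)] by fastforce
    then show "\<forall>\<^sub>F b in sequentially. t \<noteq> Min F \<longrightarrow> 1 / real (Suc b) < t - Min F"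
      using small by (cases "t = Min F") auto
  qed
  moreover have "\<forall>\<^sub>F b in sequentially. 1 / real (Suc b) < Min F"
    using F by (intro small) (auto dest: Min_in)
  ultimately show ?thesis
    using eventually_ge_at_top[of q]
  proof eventually_elim
    case (elim b)
    let ?Y = "\<Sum>n<L b. cscale (y b n) (unit_seq n)"
    show ?case
    proof
      assume sb: "s b = Min F"
      define h where "h t = (B ^^ m b) (gen t) - (if t = s b then ?Y else 0)" for t
      have h_X: "h t \<in> X" if "t \<in> F" for t
        unfolding h_def using F(3) that X_zero
        by (intro X_diff iterate_X gen_X) (auto simp: partial_sum_X)
      have h_le: "N q (h t) \<le> 2 * (1/2) ^ b" if "t \<in> F" for t
        unfolding h_def
      proof (rule gen_orbit_estimate)
        show "t = s b \<or> s b + 1 / real (Suc b) \<le> t"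
          using elim(1) that sb by fastforce
        show "1 / real (Suc b) \<le> t"
          using elim(2) Min_le[OF F(1) that] by linarith
      qed (use q elim(3) in auto)
      have "(\<Sum>t\<in>F. cscale (a t) (if t = s b then ?Y else 0)) = cscale (a (Min F)) ?Y"
      proof -
        have "(\<Sum>t\<in>F. cscale (a t) (if t = s b then ?Y else 0)) = (\<Sum>t\<in>F. if t = Min F then cscale (a t) ?Y else 0)"
          by (intro sum.cong refl) (simp add: sb)
        then show ?thesis
          using F by (simp add: sum.delta')
      qed
      then have "(B ^^ m b) (\<Sum>t\<in>F. cscale (a t) (gen t)) - cscale (a (Min F)) ?Y = (\<Sum>t\<in>F. cscale (a t) (h t))"
        by (simp add: iterate_sum h_def cseq.scale_right_diff_distrib sum_subtractf)
      moreover have "N q (\<Sum>t\<in>F. cscale (a t) (h t)) \<le> (\<Sum>t\<in>F. N q (cscale (a t) (h t)))"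
        by (intro N_sum_le q X_scale h_X)
      moreover have "(\<Sum>t\<in>F. N q (cscale (a t) (h t))) \<le> (\<Sum>t\<in>F. cmod (a t) * (2 * (1/2) ^ b))"
        by (intro sum_mono) (simp add: N_scale[OF q h_X] h_le mult_left_mono)
      ultimately show "N q ((B ^^ m b) (\<Sum>t\<in>F. cscale (a t) (gen t)) - cscale (a (Min F)) ?Y)
          \<le> (\<Sum>t\<in>F. cmod (a t)) * 2 * (1/2) ^ b"
        by (simp add: sum_distrib_right mult.assoc)
    qed
  qed
qed

end

locale hypercyclic_generators = hypercyclic_blocks +
  assumes dense_targets: "\<And>t M z \<epsilon> b\<^sub>0. 0 < t \<Longrightarrow> t \<in> \<rat> \<Longrightarrow> 0 < \<epsilon> \<Longrightarrow>
      \<exists>b\<ge>b\<^sub>0. s b = t \<and> L b = M \<and> (\<forall>n<M. cmod (y b n - z n) < \<epsilon>)"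
begin

text \<open>Three errors of size \<epsilon>/3 are added: truncating \<open>u\<close> to a finite
  section, approximating this section by a target, and replacing the shifted combination by the
  target of its leading term.\<close>

lemma combination_orbit_dense:
  assumes F: "finite F" "F \<noteq> {}" "F \<subseteq> {0<..} \<inter> \<rat>" and a: "\<forall>t\<in>F. a t \<noteq> 0"
    and u: "u \<in> X" and q: "1 \<le> q" and \<epsilon>: "0 < \<epsilon>"
  shows "\<exists>k. N q ((B ^^ k) (\<Sum>t\<in>F. cscale (a t) (gen t)) - u) < \<epsilon>"
proof -
  let ?P = "\<Sum>t\<in>F. cscale (a t) (gen t)"
  define c where "c = a (Min F)"
  have Min_F: "Min F \<in> F"
    using F by simp
  then have c: "c \<noteq> 0" and t: "0 < Min F" "Min F \<in> \<rat>"
    using a F(3) by (auto simp: c_def)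
  have P_X: "?P \<in> X"
    using F(3) by (intro combination_X) auto
  have "\<forall>\<^sub>F M in sequentially. N q ((\<Sum>n<M. cscale (u n) (unit_seq n)) - u) < \<epsilon> / 3"
    using \<epsilon> by (intro order_tendstoD(2)[OF basis_expansion_norm[OF u q]]) simp
  then obtain M where M: "N q ((\<Sum>n<M. cscale (u n) (unit_seq n)) - u) < \<epsilon> / 3"
    using eventually_happens sequentially_bot by blast
  define S where "S = (\<Sum>n<M. N q (unit_seq n))"
  have S: "0 \<le> S"
    unfolding S_def by (intro sum_nonneg N_nonneg q unit_seq_X)
  \<comment> \<open>The summand 1 keeps the denominator positive and the resulting inequality strict
    even if \<open>S = 0\<close>.\<close>
  define \<delta> where "\<delta> = \<epsilon> / (3 * cmod c * (S + 1))"
  have \<delta>: "0 < \<delta>" "cmod c * \<delta> * S < \<epsilon> / 3"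
    using \<epsilon> c S by (auto simp: \<delta>_def divide_simps)
  have "(\<lambda>b. (\<Sum>t\<in>F. cmod (a t)) * 2 * (1/2) ^ b) \<longlonglongrightarrow> 0"
    by (intro tendsto_mult_right_zero LIMSEQ_realpow_zero) auto
  then have "\<forall>\<^sub>F b in sequentially. (\<Sum>t\<in>F. cmod (a t)) * 2 * (1/2) ^ b < \<epsilon> / 3"
    using \<epsilon> by (intro order_tendstoD(2)) auto
  moreover have "F \<subseteq> {0<..}"
    using F(3) by auto
  note combination_orbit_estimate[OF F(1,2) this q, of a]
  ultimately have "\<forall>\<^sub>F b in sequentially. s b = Min F \<longrightarrow>
      N q ((B ^^ m b) ?P - cscale c (\<Sum>n<L b. cscale (y b n) (unit_seq n))) < \<epsilon> / 3"
    unfolding c_def by eventually_elim linarith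
  then obtain b\<^sub>0 where b\<^sub>0: "\<And>b. b\<^sub>0 \<le> b \<Longrightarrow> s b = Min F \<Longrightarrow>
      N q ((B ^^ m b) ?P - cscale c (\<Sum>n<L b. cscale (y b n) (unit_seq n))) < \<epsilon> / 3"
    unfolding eventually_sequentially by blast
  \<comment> \<open>The block's target approximates \<open>u / c\<close>, because it will be
    multiplied by the leading coefficient \<open>c\<close>.\<close>
  obtain b where b: "b\<^sub>0 \<le> b" "s b = Min F" "L b = M" "\<And>n. n < M \<Longrightarrow> cmod (y b n - u n / c) < \<delta>"
    using dense_targets[OF t \<delta>(1), of b\<^sub>0 M "\<lambda>n. u n / c"] by blast
  let ?Y = "cscale c (\<Sum>n<M. cscale (y b n) (unit_seq n))"
  let ?u = "\<Sum>n<M. cscale (u n) (unit_seq n)"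
  have "N q (?Y - ?u) \<le> cmod c * \<delta> * S"
  proof -
    have "?Y - ?u = (\<Sum>n<M. cscale (c * (y b n - u n / c)) (unit_seq n))"
      using c by (simp add: cseq.scale_sum_right sum_subtractf[symmetric] cseq.scale_left_diff_distrib[symmetric] right_diff_distrib)
    moreover have "N q (\<Sum>n<M. cscale (c * (y b n - u n / c)) (unit_seq n))
        \<le> (\<Sum>n<M. N q (cscale (c * (y b n - u n / c)) (unit_seq n)))"
      by (intro N_sum_le q X_scale unit_seq_X)
    moreover have "(\<Sum>n<M. N q (cscale (c * (y b n - u n / c)) (unit_seq n))) \<le> (\<Sum>n<M. cmod c * \<delta> * N q (unit_seq n))"
    proof (intro sum_mono)
      fix n assume "n \<in> {..<M}"
      then have "cmod c * cmod (y b n - u n / c) * N q (unit_seq n) \<le> cmod c * \<delta> * N q (unit_seq n)"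
        using b(4)[of n] by (intro mult_right_mono mult_left_mono N_nonneg q unit_seq_X) auto
      then show "N q (cscale (c * (y b n - u n / c)) (unit_seq n)) \<le> cmod c * \<delta> * N q (unit_seq n)"
        by (simp only: N_scale[OF q unit_seq_X] norm_mult)
    qed
    ultimately show ?thesis
      by (simp add: S_def sum_distrib_left)
  qed
  moreover have "N q ((B ^^ m b) ?P - ?Y) < \<epsilon> / 3"
    using b\<^sub>0[OF b(1,2)] b(3) by simp
  moreover have "N q ((B ^^ m b) ?P - u) \<le> N q ((B ^^ m b) ?P - ?Y) + N q (?Y - u)"
    by (intro N_triangle_diff q iterate_X P_X X_scale partial_sum_X u)
  moreover have "N q (?Y - u) \<le> N q (?Y - ?u) + N q (?u - u)"
    by (intro N_triangle_diff q X_scale partial_sum_X u)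
  ultimately have "N q ((B ^^ m b) ?P - u) < \<epsilon>"
    using M \<delta>(2) by linarith
  then show ?thesis by blast
qed

lemma combination_HC:
  assumes "finite F" "F \<noteq> {}" "F \<subseteq> {0<..} \<inter> \<rat>" "\<forall>t\<in>F. a t \<noteq> 0"
  shows "(\<Sum>t\<in>F. cscale (a t) (gen t)) \<in> HC X N B"
proof -
  let ?P = "\<Sum>t\<in>F. cscale (a t) (gen t)"
  have P_X: "?P \<in> X"
    using assms(3) by (intro combination_X) auto
  have "u \<in> \<T> closure_of (range (\<lambda>k. (B ^^ k) ?P))" if u: "u \<in> X" for u
    unfolding in_closure_of topspace_seminorm_topology
  proof (intro conjI allI impI u)
    fix V assume V: "u \<in> V \<and> openin \<T> V"
    then obtain q r where qr: "1 \<le> q" "0 < r" "{y \<in> X. N q (y - u) < r} \<subseteq> V"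
      using openin_contains_seminorm_ball by blast
    obtain k where "N q ((B ^^ k) ?P - u) < r"
      using combination_orbit_dense[OF assms u qr(1,2)] by blast
    with qr(3) iterate_X[OF P_X] show "\<exists>y. y \<in> range (\<lambda>k. (B ^^ k) ?P) \<and> y \<in> V"
      by blast
  qed
  then have "\<T> closure_of (range (\<lambda>k. (B ^^ k) ?P)) = X"
    using closure_of_subset_topspace[of \<T>] topspace_seminorm_topology by blast
  with P_X show ?thesis
    by (simp add: HC_def)
qed

text \<open>The generators are linearly independent: the orbit of 0 stays at 0, so its density would
  make every seminorm of \<open>unit_seq 0\<close> vanish, and the constant sequence 0 would
  converge to \<open>unit_seq 0\<close>.\<close>

lemma combination_nonzero:
  assumes "finite F" "F \<noteq> {}" "F \<subseteq> {0<..} \<inter> \<rat>" "\<forall>t\<in>F. a t \<noteq> 0"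
  shows "(\<Sum>t\<in>F. cscale (a t) (gen t)) \<noteq> 0"
proof
  assume P: "(\<Sum>t\<in>F. cscale (a t) (gen t)) = 0"
  have zero: "(B ^^ k) 0 = 0" for k
    by (auto simp: fun_eq_iff iterate_apply)
  have small: "N q (0 - unit_seq 0) = 0" if q: "1 \<le> q" for q
  proof (rule antisym[OF field_le_epsilon])
    show "N q (0 - unit_seq 0) \<le> 0 + \<epsilon>" if "0 < \<epsilon>" for \<epsilon>
      using combination_orbit_dense[OF assms unit_seq_X q that, of 0] unfolding P zero by simp
    show "0 \<le> N q (0 - unit_seq 0)"
      by (intro N_nonneg q X_diff X_zero unit_seq_X)
  qed
  have "range (\<lambda>i::nat. 0 :: cseq) \<subseteq> X"
    using X_zero by blast
  then have "limitin \<T> (\<lambda>i. 0) (unit_seq 0) sequentially"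
    using limitin_iff[of "\<lambda>i. 0" "unit_seq 0"] unit_seq_X small by simp
  from limitin_coordinate[OF this, of 0] show False
    by (simp add: unit_seq_def LIMSEQ_const_iff)
qed

text \<open>Exponents are rational because only rational ones are paired with a dense family of
  targets. The value \<open>c = 0\<close> gives the desired algebra; positive \<open>c\<close> gives
  subalgebras that confine its finite subsets.\<close>

definition gen_span :: "real \<Rightarrow> cseq set" where
  "gen_span c = cseq.span (gen ` ({t. c \<le> t \<and> 0 < t} \<inter> \<rat>))"

lemma gen_span_combination:
  assumes "f \<in> gen_span c"
  obtains F a where "finite F" "F \<subseteq> {t. c \<le> t \<and> 0 < t} \<inter> \<rat>" "\<And>t. t \<in> F \<Longrightarrow> a t \<noteq> 0"
    "f = (\<Sum>t\<in>F. cscale (a t) (gen t))"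
proof -
  obtain T r where T: "finite T" "T \<subseteq> gen ` ({t. c \<le> t \<and> 0 < t} \<inter> \<rat>)" "f = (\<Sum>g\<in>T. cscale (r g) g)"
    using assms unfolding gen_span_def cseq.span_explicit by blast
  \<comment> \<open>One exponent is selected for each generator in \<open>T\<close>, since
    injectivity of \<open>gen\<close> has not been established at this point.\<close>
  obtain F where F: "F \<subseteq> {t. c \<le> t \<and> 0 < t} \<inter> \<rat>" "inj_on gen F" "T = gen ` F"
    using T(2) unfolding subset_image_inj by blast
  have fin: "finite F"
    using T(1) F(2,3) finite_image_iff by blast
  show thesis
  proof (rule that[of "{t \<in> F. r (gen t) \<noteq> 0}" "\<lambda>t. r (gen t)"])
    have "f = (\<Sum>t\<in>F. cscale (r (gen t)) (gen t))"
      unfolding T(3) F(3) by (simp add: sum.reindex[OF F(2)])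
    \<comment> \<open>Zero coefficients are dropped so that the smallest remaining exponent really
      carries the leading term.\<close>
    also have "\<dots> = (\<Sum>t\<in>{t \<in> F. r (gen t) \<noteq> 0}. cscale (r (gen t)) (gen t))"
      using fin by (intro sum.mono_neutral_right) auto
    finally show "f = (\<Sum>t\<in>{t \<in> F. r (gen t) \<noteq> 0}. cscale (r (gen t)) (gen t))" .
  qed (use F(1) fin in auto)
qed

lemma gen_in_gen_span: "c \<le> t \<Longrightarrow> 0 < t \<Longrightarrow> t \<in> \<rat> \<Longrightarrow> gen t \<in> gen_span c"
  unfolding gen_span_def by (intro cseq.span_base) auto

lemma subspace_gen_span: "cseq.subspace (gen_span c)"
  unfolding gen_span_def by (rule cseq.subspace_span)

lemma gen_span_antimono: "c \<le> c' \<Longrightarrow> gen_span c' \<subseteq> gen_span c"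
  unfolding gen_span_def by (intro cseq.span_mono image_mono) auto

text \<open>Products of generators add exponents, and adding a positive rational preserves the lower
  bound \<open>c\<close>.\<close>

lemma subalgebra_gen_span: "subalgebra (gen_span c)"
proof -
  have "f * g \<in> gen_span c" if fg: "f \<in> gen_span c" "g \<in> gen_span c" for f g
  proof -
    obtain F a where F: "F \<subseteq> {t. c \<le> t \<and> 0 < t} \<inter> \<rat>" "f = (\<Sum>t\<in>F. cscale (a t) (gen t))"
      using gen_span_combination[OF fg(1)] by metis
    obtain G b where G: "G \<subseteq> {t. c \<le> t \<and> 0 < t} \<inter> \<rat>" "g = (\<Sum>t\<in>G. cscale (b t) (gen t))"
      using gen_span_combination[OF fg(2)] by metis
    have "f * g = (\<Sum>t\<in>F. \<Sum>t'\<in>G. cscale (a t * b t') (gen (t + t')))"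
      unfolding F G sum_product
      by (intro sum.cong refl) (simp add: fun_eq_iff gen_mult[symmetric])
    moreover have "\<dots> \<in> gen_span c"
    proof (intro cseq.subspace_sum cseq.subspace_scale subspace_gen_span gen_in_gen_span)
      fix t t' assume "t \<in> F" "t' \<in> G"
      with F(1) G(1) have "c \<le> t" "0 < t" "t \<in> \<rat>" "0 < t'" "t' \<in> \<rat>"
        by auto
      then show "c \<le> t + t'" "0 < t + t'" "t + t' \<in> \<rat>"
        by auto
    qed
    ultimately show ?thesis by simp
  qed
  then show ?thesis
    unfolding subalgebra_def using subspace_gen_span by blast
qed

lemma gen_span_subset_X: "gen_span c \<subseteq> X"
  unfolding gen_span_def using gen_X by (intro cseq.span_minimal subspace_X) auto

lemma gen_span_HC: "gen_span c - {0} \<subseteq> HC X N B"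
proof
  fix f assume f: "f \<in> gen_span c - {0}"
  then obtain F a where F: "finite F" "F \<subseteq> {t. c \<le> t \<and> 0 < t} \<inter> \<rat>" "\<And>t. t \<in> F \<Longrightarrow> a t \<noteq> 0"
      "f = (\<Sum>t\<in>F. cscale (a t) (gen t))"
    using gen_span_combination[of f c] by blast
  moreover from this f have "F \<noteq> {}"
    by auto
  moreover have "F \<subseteq> {0<..} \<inter> \<rat>"
    using F(2) by auto
  ultimately show "f \<in> HC X N B"
    using combination_HC by simp
qed

text \<open>Otherwise moving \<open>gen t\<close> to the other side, with coefficient -1, gives a
  vanishing combination with nonzero coefficients.\<close>

lemma gen_notin_gen_span:
  assumes "0 < t" "t \<in> \<rat>" "t < c"
  shows "gen t \<notin> gen_span c"
proof
  assume "gen t \<in> gen_span c"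
  then obtain F a where F: "finite F" "F \<subseteq> {t. c \<le> t \<and> 0 < t} \<inter> \<rat>" "\<And>t. t \<in> F \<Longrightarrow> a t \<noteq> 0"
      "gen t = (\<Sum>t\<in>F. cscale (a t) (gen t))"
    using gen_span_combination[of "gen t" c] by blast
  have t: "t \<notin> F"
    using F(2) assms(3) by auto
  define a' where "a' = a(t := -1)"
  have "(\<Sum>t\<in>F. cscale (a' t) (gen t)) = (\<Sum>t\<in>F. cscale (a t) (gen t))"
    using t by (intro sum.cong refl) (auto simp: a'_def)
  then have "(\<Sum>t\<in>insert t F. cscale (a' t) (gen t)) = 0"
    unfolding sum.insert[OF F(1) t] F(4)[symmetric] by (simp add: a'_def fun_eq_iff)
  moreover have "(\<Sum>t\<in>insert t F. cscale (a' t) (gen t)) \<noteq> 0"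
    using F assms by (intro combination_nonzero) (auto simp: a'_def)
  ultimately show False by contradiction
qed

lemma gen_span_bounded_below:
  assumes "finite S" "S \<subseteq> gen_span 0"
  shows "\<exists>c>0. S \<subseteq> gen_span c"
  using assms
proof (induction S)
  case empty
  then show ?case
    by (intro exI[of _ 1]) auto
next
  case (insert f S)
  then obtain c where c: "0 < c" "S \<subseteq> gen_span c"
    by auto
  from insert.prems have "f \<in> gen_span 0"
    by simp
  then obtain F a where F: "finite F" "F \<subseteq> {t. 0 \<le> t \<and> 0 < t} \<inter> \<rat>"
      "\<And>t. t \<in> F \<Longrightarrow> a t \<noteq> 0" "f = (\<Sum>t\<in>F. cscale (a t) (gen t))"
    by (rule gen_span_combination) blast
  \<comment> \<open>Including \<open>c\<close> preserves the bound for \<open>S\<close> and keeps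
    the minimum meaningful when \<open>F\<close> is empty.\<close>
  define c' where "c' = Min (insert c F)"
  have c': "0 < c'" "c' \<le> c" "\<And>t. t \<in> F \<Longrightarrow> c' \<le> t"
    using c(1) F by (auto simp: c'_def)
  have "f \<in> gen_span c'"
    unfolding F(4) using F(2) c'(3)
    by (intro cseq.subspace_sum cseq.subspace_scale subspace_gen_span gen_in_gen_span) auto
  with c(2) gen_span_antimono[OF c'(2)] c'(1) show ?case
    by blast
qed

text \<open>
  Finitely many generators have exponents bounded below by some \<open>c > 0\<close>, and so has every
  product of them.
\<close>

lemma not_finitely_generated_gen_span: "\<not> finitely_generated (gen_span 0)"
proof
  assume "finitely_generated (gen_span 0)"
  then obtain S where S: "finite S" "S \<subseteq> gen_span 0" "subalgebra hull S = gen_span 0"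
    unfolding finitely_generated_def generates_algebra_def by blast
  obtain c where c: "0 < c" "S \<subseteq> gen_span c"
    using gen_span_bounded_below[OF S(1,2)] by blast
  obtain t where t: "t \<in> \<rat>" "0 < t" "t < c"
    using Rats_dense_in_real[OF c(1)] by blast
  have "gen_span 0 \<subseteq> gen_span c"
    using hull_minimal[of S "gen_span c" subalgebra] c(2) subalgebra_gen_span S(3) by simp
  then show False
    using gen_in_gen_span[of 0 t] gen_notin_gen_span[of t c] t by auto
qed

text \<open>The algebra generates itself; were it finite, it would be its own finite generating
  set.\<close>

lemma algebrable_HC: "algebrable X (HC X N B)"
proof -
  have gen: "generates_algebra (gen_span 0) (gen_span 0)"
    unfolding generates_algebra_def by (simp add: hull_same subalgebra_gen_span)
  then have "infinite (gen_span 0)"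
    using not_finitely_generated_gen_span unfolding finitely_generated_def by blast
  with gen have "infinitely_generated (gen_span 0)"
    unfolding infinitely_generated_def by blast
  then show ?thesis
    unfolding algebrable_def
    using subalgebra_gen_span gen_span_subset_X not_finitely_generated_gen_span gen_span_HC by blast
qed

end

theorem theorem2p7:
  fixes X :: "cseq set" and N :: "nat \<Rightarrow> cseq \<Rightarrow> real"
    and w v :: "nat \<Rightarrow> complex" and p :: "nat \<Rightarrow> nat"
  assumes "frechet_sequence_algebra X N"
    and "schauder_basis X N unit_seq"
    and "property_A X N"
    and "weighted_shift_on X w"
    and "hypercyclic X N (backward_shift w)"
    and v: "\<And>n. v n = (\<Prod>k=0..n. w k)"
    and "strict_mono p"
    and "\<And>n. limitin (seminorm_topology X N)
                (\<lambda>k. cscale (inverse (v (p k + n))) (unit_seq (p k + n))) 0 sequentially"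
    and "\<And>n. (\<lambda>k. \<Prod>\<nu>=0..p k + n. inverse (w \<nu>)) \<longlonglongrightarrow> 0"
  shows "(\<exists>A. subalgebra A \<and> A \<subseteq> X \<and> \<not> finitely_generated A \<and>
              A - {0} \<subseteq> HC X N (backward_shift w))
         \<and> algebrable X (HC X N (backward_shift w))"
proof -
  interpret backward_shift_algebra X N w v p
  proof
    \<comment> \<open>The hypothesis is stated for a product of inverses, which is the inverse of
      the product \<open>v\<close>.\<close>
    show "(\<lambda>k. inverse (v (p k + n))) \<longlonglongrightarrow> 0" for n
      using assms(9)[of n] unfolding v prod_inversef[symmetric] o_def .
  qed (fact assms)+
  show ?thesis
  proof (rule exists_target_enumeration)
    fix s :: "nat \<Rightarrow> real" and L :: "nat \<Rightarrow> nat" and y :: "nat \<Rightarrow> nat \<Rightarrow> complex"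
    assume sy: "\<And>b. 0 < s b" "\<And>b n. y b n \<noteq> 0"
      and dense: "\<And>t M z \<epsilon> b\<^sub>0. 0 < t \<Longrightarrow> t \<in> \<rat> \<Longrightarrow> 0 < \<epsilon> \<Longrightarrow>
        \<exists>b\<ge>b\<^sub>0. s b = t \<and> L b = M \<and> (\<forall>n<M. cmod (y b n - z n) < \<epsilon>)"
    obtain m U where "hypercyclic_blocks X N w v p s L m y U"
      by (rule exists_hypercyclic_blocks[of s y L, OF sy])
    then interpret hypercyclic_generators X N w v p s L m y U
      by (intro hypercyclic_generators.intro hypercyclic_generators_axioms.intro dense)
    show ?thesis
      by (intro conjI exI[of _ "gen_span 0"] subalgebra_gen_span gen_span_subset_X
          not_finitely_generated_gen_span gen_span_HC algebrable_HC)
  qed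
qed

end
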